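(* Let $A$ be a finitely generated abelian group. Suppose that there exist two monomorphisms (injective group homomorphisms) $\lambda,\mu: A\to A$ with the following properties: 1) $\lambda\circ\mu=\mu\circ\lambda$; 2) the subgroup of $A$ generated by $\lambda(A)\cup\mu(A)$ coincides with $A$; 3) $\lambda(A)\cup\mu(A)\ne A$ (as sets). Then the HNN-extension $$G=\langle A, t \;:\; t^{-1}\lambda(a)t=\mu(a),\ a\in A\rangle$$ is a finitely generated weakly amenable non-amenable group.
   Context: For a (discrete) finitely generated group $G$, acting on $\ell^2(G)=L^2(G)$ by the left regular representation, and a finite subset $S\subseteq G$, let $\alpha(G,S)$ be the supremum of all $\varepsilon\ge 0$ such that for every $v\in \ell^2(G)$ with $\|v\|=1$ there exists $s\in S$ with $\|sv-v\|\ge\varepsilon$. Put $\alpha(G)=\inf_S\alpha(G,S)$, where $S$ ranges over all finite generating sets of $G$. A finitely generated group $G$ is called weakly amenable (in the sense of this paper) if $\alpha(G)=0$. A (discrete) group is amenable if it admits a finitely additive left-invariant measure $\mu$ on all its subsets with $\mu(G)=1$. The HNN-extension $G$ is the group generated by $A$ and a stable letter $t$, subject to the relations of $A$ and the relations $t^{-1}\lambda(a)t=\mu(a)$ for all $a\in A$; the associated subgroups are $\lambda(A)$ and $\mu(A)$. *)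

theory Defs
  imports "HOL-Analysis.Analysis" "HOL-Algebra.Generated_Groups"
begin

section \<open>Groups given by generators and relations\<close>

text \<open>A letter \<open>(x, True)\<close> stands for the generator \<open>x\<close> and \<open>(x, False)\<close> for its formal inverse.
  A relation \<open>r = s\<close> between words is represented by the pair \<open>(r, s)\<close>.\<close>

type_synonym 'x word = "('x \<times> bool) list"

definition words :: "'x set \<Rightarrow> 'x word set" where
  "words X = lists (X \<times> UNIV)"

inductive_set word_eq :: "'x set \<Rightarrow> ('x word \<times> 'x word) set \<Rightarrow> ('x word \<times> 'x word) set"
  for X :: "'x set" and R :: "('x word \<times> 'x word) set" where
  refl: "u \<in> words X \<Longrightarrow> (u, u) \<in> word_eq X R"
| sym: "(u, v) \<in> word_eq X R \<Longrightarrow> (v, u) \<in> word_eq X R"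
| trans: "(u, v) \<in> word_eq X R \<Longrightarrow> (v, w) \<in> word_eq X R \<Longrightarrow> (u, w) \<in> word_eq X R"
| cancel: "u \<in> words X \<Longrightarrow> v \<in> words X \<Longrightarrow> x \<in> X \<Longrightarrow>
    (u @ [(x, b), (x, \<not> b)] @ v, u @ v) \<in> word_eq X R"
| relation: "u \<in> words X \<Longrightarrow> v \<in> words X \<Longrightarrow> r \<in> words X \<Longrightarrow> s \<in> words X \<Longrightarrow> (r, s) \<in> R \<Longrightarrow>
    (u @ r @ v, u @ s @ v) \<in> word_eq X R"

definition presented_group :: "'x set \<Rightarrow> ('x word \<times> 'x word) set \<Rightarrow> 'x word set monoid" where
  "presented_group X R =
    \<lparr>carrier = words X // word_eq X R,
     mult = (\<lambda>P Q. \<Union>p\<in>P. \<Union>q\<in>Q. word_eq X R `` {p @ q}),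
     one = word_eq X R `` {[]}\<rparr>"

lemma words_append [simp]: "u @ v \<in> words X \<longleftrightarrow> u \<in> words X \<and> v \<in> words X"
  by (auto simp: words_def)

lemma words_Nil [simp]: "[] \<in> words X"
  by (simp add: words_def)

lemma words_Cons [simp]: "a # u \<in> words X \<longleftrightarrow> fst a \<in> X \<and> u \<in> words X"
  by (cases a) (auto simp: words_def)

lemma word_eq_words: "(u, v) \<in> word_eq X R \<Longrightarrow> u \<in> words X \<and> v \<in> words X"
  by (induction rule: word_eq.induct) auto

lemma equiv_word_eq: "equiv (words X) (word_eq X R)"
  by (rule equivI)
    (auto simp: refl_on_def Relation.sym_def Relation.trans_def dest: word_eq_words
      intro: word_eq.intros)

lemma word_eq_context:
  assumes "(u, v) \<in> word_eq X R" "a \<in> words X" "b \<in> words X"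
  shows "(a @ u @ b, a @ v @ b) \<in> word_eq X R"
  using assms
proof (induction rule: word_eq.induct)
  case (cancel u v x c)
  then show ?case using word_eq.cancel[of "a @ u" X "v @ b" x c R] by simp
next
  case (relation u v r s)
  then show ?case using word_eq.relation[of "a @ u" X "v @ b" r s R] by simp
qed (auto intro: word_eq.intros)

lemma word_eq_append:
  assumes "(u, u') \<in> word_eq X R" "(v, v') \<in> word_eq X R"
  shows "(u @ v, u' @ v') \<in> word_eq X R"
proof -
  have "(u @ v, u' @ v) \<in> word_eq X R"
    using word_eq_context[OF assms(1), of "[]" v] word_eq_words[OF assms(2)] by simp
  moreover have "(u' @ v, u' @ v') \<in> word_eq X R"
    using word_eq_context[OF assms(2), of u' "[]"] word_eq_words[OF assms(1)] by simp
  ultimately show ?thesis by (rule word_eq.trans)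
qed

lemma presented_group_mult:
  assumes "u \<in> words X" "v \<in> words X"
  shows "word_eq X R `` {u} \<otimes>\<^bsub>presented_group X R\<^esub> word_eq X R `` {v} = word_eq X R `` {u @ v}"
proof -
  have "congruent2 (word_eq X R) (word_eq X R) (\<lambda>p q. word_eq X R `` {p @ q})"
    by (rule congruent2I')
      (metis equiv_class_eq equiv_word_eq word_eq_append)
  then show ?thesis
    using UN_equiv_class2[OF equiv_word_eq equiv_word_eq _ assms]
    by (simp add: presented_group_def)
qed

definition word_inv :: "'x word \<Rightarrow> 'x word" where
  "word_inv u = rev (map (\<lambda>(x, b). (x, \<not> b)) u)"

lemma word_inv_words [simp]: "u \<in> words X \<Longrightarrow> word_inv u \<in> words X"
  by (induction u) (auto simp: word_inv_def)

lemma word_inv_cancel: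
  assumes "u \<in> words X"
  shows "(word_inv u @ u, []) \<in> word_eq X R"
  using assms
proof (induction u)
  case Nil
  then show ?case by (simp add: word_inv_def word_eq.refl)
next
  case (Cons a u)
  obtain x b where a: "a = (x, b)" by (cases a)
  have "(word_inv u @ [(x, \<not> b), (x, \<not> \<not> b)] @ u, word_inv u @ u) \<in> word_eq X R"
    using Cons.prems a by (intro word_eq.cancel) auto
  then show ?case
    using Cons a by (auto simp: word_inv_def intro: word_eq.trans)
qed

lemma group_presented_group: "group (presented_group X R)"
proof (rule groupI)
  let ?G = "presented_group X R" and ?c = "\<lambda>u. word_eq X R `` {u}"
  have rep: "\<exists>u \<in> words X. P = ?c u" if "P \<in> carrier ?G" for P
    using that by (auto simp: presented_group_def elim: quotientE)
  have cl: "?c u \<in> carrier ?G" if "u \<in> words X" for u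
    using that by (simp add: presented_group_def quotientI)
  have one: "\<one>\<^bsub>?G\<^esub> = ?c []" by (simp add: presented_group_def)
  show "\<one>\<^bsub>?G\<^esub> \<in> carrier ?G" by (simp add: one cl)
  show "P \<otimes>\<^bsub>?G\<^esub> Q \<in> carrier ?G" if "P \<in> carrier ?G" "Q \<in> carrier ?G" for P Q
    using rep[OF that(1)] rep[OF that(2)] by (auto simp: presented_group_mult cl)
  show "P \<otimes>\<^bsub>?G\<^esub> Q \<otimes>\<^bsub>?G\<^esub> S = P \<otimes>\<^bsub>?G\<^esub> (Q \<otimes>\<^bsub>?G\<^esub> S)"
    if "P \<in> carrier ?G" "Q \<in> carrier ?G" "S \<in> carrier ?G" for P Q S
    using rep[OF that(1)] rep[OF that(2)] rep[OF that(3)] by (auto simp: presented_group_mult)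
  show "\<one>\<^bsub>?G\<^esub> \<otimes>\<^bsub>?G\<^esub> P = P" if "P \<in> carrier ?G" for P
    using rep[OF that] by (auto simp: presented_group_mult one)
  show "\<exists>Q\<in>carrier ?G. Q \<otimes>\<^bsub>?G\<^esub> P = \<one>\<^bsub>?G\<^esub>" if P: "P \<in> carrier ?G" for P
  proof -
    obtain u where u: "u \<in> words X" "P = ?c u" using rep[OF P] by blast
    then have "?c (word_inv u) \<otimes>\<^bsub>?G\<^esub> P = \<one>\<^bsub>?G\<^esub>"
      by (simp add: presented_group_mult one equiv_class_eq[OF equiv_word_eq word_inv_cancel])
    then show ?thesis using u cl word_inv_words by blast
  qed
qed


section \<open>HNN-extensions\<close>

datatype 'a hnn_gen = Base 'a | Stable

definition hnn_gens :: "('a, 'm) monoid_scheme \<Rightarrow> 'a hnn_gen set" where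
  "hnn_gens A = insert Stable (Base ` carrier A)"

text \<open>The relations of \<open>A\<close> are given by its multiplication table.\<close>

definition hnn_relations ::
  "('a, 'm) monoid_scheme \<Rightarrow> ('a \<Rightarrow> 'a) \<Rightarrow> ('a \<Rightarrow> 'a) \<Rightarrow> ('a hnn_gen word \<times> 'a hnn_gen word) set" where
  "hnn_relations A l m =
    {([(Base a, True), (Base b, True)], [(Base (a \<otimes>\<^bsub>A\<^esub> b), True)]) | a b.
      a \<in> carrier A \<and> b \<in> carrier A} \<union>
    {([(Stable, False), (Base (l a), True), (Stable, True)], [(Base (m a), True)]) | a.
      a \<in> carrier A}"

definition HNN ::
  "('a, 'm) monoid_scheme \<Rightarrow> ('a \<Rightarrow> 'a) \<Rightarrow> ('a \<Rightarrow> 'a) \<Rightarrow> 'a hnn_gen word set monoid" where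
  "HNN A l m = presented_group (hnn_gens A) (hnn_relations A l m)"


section \<open>Finite generation, weak amenability and amenability\<close>

definition finite_generating_set :: "('g, 'm) monoid_scheme \<Rightarrow> 'g set \<Rightarrow> bool" where
  "finite_generating_set G S \<longleftrightarrow> finite S \<and> S \<subseteq> carrier G \<and> generate G S = carrier G"

definition finitely_generated :: "('g, 'm) monoid_scheme \<Rightarrow> bool" where
  "finitely_generated G \<longleftrightarrow> (\<exists>S. finite_generating_set G S)"

text \<open>Elements of \<open>\<ell>\<^sup>2(G)\<close> are functions on the whole type that vanish off the carrier.\<close>

definition ell2 :: "('g, 'm) monoid_scheme \<Rightarrow> ('g \<Rightarrow> complex) set" where
  "ell2 G = {v. (\<forall>x. x \<notin> carrier G \<longrightarrow> v x = 0) \<and> (\<lambda>x. (norm (v x))\<^sup>2) summable_on carrier G}"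

definition ell2_norm :: "('g, 'm) monoid_scheme \<Rightarrow> ('g \<Rightarrow> complex) \<Rightarrow> real" where
  "ell2_norm G v = sqrt (\<Sum>\<^sub>\<infinity>x\<in>carrier G. (norm (v x))\<^sup>2)"

definition left_regular :: "('g, 'm) monoid_scheme \<Rightarrow> 'g \<Rightarrow> ('g \<Rightarrow> complex) \<Rightarrow> ('g \<Rightarrow> complex)" where
  "left_regular G s v = (\<lambda>x. if x \<in> carrier G then v (inv\<^bsub>G\<^esub> s \<otimes>\<^bsub>G\<^esub> x) else 0)"

text \<open>Suprema and infima are taken in \<open>[0, \<infinity>]\<close>, so that the supremum of the empty set,
  which occurs for \<open>S = {}\<close>, is \<open>0\<close>.\<close>

definition kazhdan_const :: "('g, 'm) monoid_scheme \<Rightarrow> 'g set \<Rightarrow> ennreal" where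
  "kazhdan_const G S =
    (SUP \<epsilon> \<in> {\<epsilon>::real. 0 \<le> \<epsilon> \<and>
        (\<forall>v \<in> ell2 G. ell2_norm G v = 1 \<longrightarrow>
          (\<exists>s \<in> S. \<epsilon> \<le> ell2_norm G (\<lambda>x. left_regular G s v x - v x)))}. ennreal \<epsilon>)"

definition uniform_kazhdan_const :: "('g, 'm) monoid_scheme \<Rightarrow> ennreal" where
  "uniform_kazhdan_const G = (INF S \<in> {S. finite_generating_set G S}. kazhdan_const G S)"

definition weakly_amenable :: "('g, 'm) monoid_scheme \<Rightarrow> bool" where
  "weakly_amenable G \<longleftrightarrow> finitely_generated G \<and> uniform_kazhdan_const G = 0"

definition amenable :: "('g, 'm) monoid_scheme \<Rightarrow> bool" where
  "amenable G \<longleftrightarrow> (\<exists>\<mu> :: 'g set \<Rightarrow> real.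
     (\<forall>X. X \<subseteq> carrier G \<longrightarrow> 0 \<le> \<mu> X) \<and>
     (\<forall>X Y. X \<subseteq> carrier G \<longrightarrow> Y \<subseteq> carrier G \<longrightarrow> X \<inter> Y = {} \<longrightarrow> \<mu> (X \<union> Y) = \<mu> X + \<mu> Y) \<and>
     (\<forall>g \<in> carrier G. \<forall>X. X \<subseteq> carrier G \<longrightarrow> \<mu> (g <#\<^bsub>G\<^esub> X) = \<mu> X) \<and>
     \<mu> (carrier G) = 1)"

end

theory Submission
  imports Defs "HOL-Algebra.Bij" "HOL-Algebra.Elementary_Groups" "HOL-Algebra.FiniteProduct"
    "HOL-Real_Asymp.Real_Asymp"
begin

text \<open>Write \<open>t\<close> for the stable letter of the HNN-extension \<open>G\<close>, and \<open>\<lambda>\<close>, \<open>\<mu>\<close> for the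
  monomorphisms \<open>l\<close>, \<open>m\<close>.

  Weak amenability. Let \<open>S\<close> be a finite generating set of \<open>A\<close> and \<open>S\<^sub>n = \<lambda>\<^sup>n(S) \<union> {t}\<close>. Since
  \<open>t\<^sup>-\<^sup>1 \<lambda>\<^sup>n\<^sup>+\<^sup>1(a) t = \<lambda>\<^sup>n(\<mu>(a))\<close> and \<open>\<lambda>(A) \<union> \<mu>(A)\<close> generates \<open>A\<close>, every \<open>S\<^sub>n\<close> generates \<open>G\<close>
  (\<open>generating_set_HNN\<close>). On the other hand \<open>\<lambda>\<^sup>n(a) t\<^sup>j = t\<^sup>j \<lambda>\<^sup>n\<^sup>-\<^sup>j(\<mu>\<^sup>j(a))\<close> for \<open>j \<le> n\<close>
  (\<open>base_stable_pow\<close>), so on the first \<open>n\<close> layers \<open>t\<^sup>j A\<close> the set \<open>S\<^sub>n\<close> acts through the abelian group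
  \<open>A\<close> and a shift of the layers. A Folner set \<open>B\<close> of \<open>A\<close>, which exists because the abelian group \<open>A\<close> has
  polynomial growth, therefore gives a Folner set \<open>{t\<^sup>j b. j < n, b \<in> B}\<close> for \<open>S\<^sub>n\<close> whose boundary is of relative
  size \<open>1 / n\<close> (\<open>folner_set_HNN\<close>), and the normalised indicator functions of these sets show that the
  infimum of the Kazhdan constants is \<open>0\<close>.

  Non-amenability. \<open>G\<close> acts on the set of Britton normal forms. Let \<open>T\<close> be the set of those that
  begin with \<open>\<lambda>(A) t\<close> and \<open>U\<close> the set of those that begin with \<open>\<mu>(A) t\<^sup>-\<^sup>1\<close>. Multiplication by \<open>t\<close> maps
  the complement of \<open>U\<close> onto \<open>T\<close>, so an invariant mean would give \<open>T\<close> and \<open>U\<close> total mass \<open>1\<close>. But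
  for \<open>c \<in> A\<close> outside \<open>\<lambda>(A) \<union> \<mu>(A)\<close> the four sets \<open>T\<close>, \<open>c T\<close>, \<open>U\<close>, \<open>c U\<close> are disjoint, so this mass is
  at most \<open>1 / 2\<close> (\<open>not_amenable_if_ping_pong\<close>, \<open>not_amenable_HNN\<close>).\<close>


section \<open>Homomorphisms out of presented groups\<close>

definition word_val :: "('g, 'm) monoid_scheme \<Rightarrow> ('x \<Rightarrow> 'g) \<Rightarrow> 'x word \<Rightarrow> 'g" where
  "word_val H f u = foldr (\<lambda>(x, b) g. (if b then f x else inv\<^bsub>H\<^esub> (f x)) \<otimes>\<^bsub>H\<^esub> g) u \<one>\<^bsub>H\<^esub>"

lemma word_val_simps [simp]:
  "word_val H f [] = \<one>\<^bsub>H\<^esub>"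
  "word_val H f ((x, b) # u) = (if b then f x else inv\<^bsub>H\<^esub> (f x)) \<otimes>\<^bsub>H\<^esub> word_val H f u"
  by (simp_all add: word_val_def)

context group
begin

lemma word_val_closed [simp]:
  assumes "f ` X \<subseteq> carrier G" "u \<in> words X"
  shows "word_val G f u \<in> carrier G"
  using assms(2)
proof (induction u)
  case (Cons a u)
  then show ?case using assms(1) by (cases a) auto
qed simp

lemma word_val_append:
  assumes "f ` X \<subseteq> carrier G" "u \<in> words X" "v \<in> words X"
  shows "word_val G f (u @ v) = word_val G f u \<otimes> word_val G f v"
  using assms(2)
proof (induction u)
  case Nil
  then show ?case using assms by simp
next
  case (Cons a u)
  then have "f (fst a) \<in> carrier G" "word_val G f u \<in> carrier G" "word_val G f v \<in> carrier G"
    using assms by auto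
  with Cons show ?case by (cases a) (auto simp: m_assoc)
qed

lemma word_val_word_eq:
  assumes f: "f ` X \<subseteq> carrier G"
    and R: "\<And>r s. (r, s) \<in> R \<Longrightarrow> r \<in> words X \<Longrightarrow> s \<in> words X \<Longrightarrow> word_val G f r = word_val G f s"
    and "(u, v) \<in> word_eq X R"
  shows "word_val G f u = word_val G f v"
  using assms(3)
proof (induction rule: word_eq.induct)
  case (cancel u v x b)
  have x: "f x \<in> carrier G" using cancel f by auto
  have v: "word_val G f v \<in> carrier G" using cancel f by simp
  have "word_val G f ([(x, b), (x, \<not> b)] @ v) = word_val G f v"
    using x v by (auto simp flip: m_assoc)
  moreover have "[(x, b), (x, \<not> b)] @ v \<in> words X" using cancel by simp
  ultimately show ?case
    using cancel by (metis word_val_append[OF f])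
next
  case (relation u v r s)
  then show ?case using R[of r s] by (simp add: word_val_append[OF f])
qed auto

end

definition presented_gen :: "'x set \<Rightarrow> ('x word \<times> 'x word) set \<Rightarrow> 'x \<Rightarrow> 'x word set" where
  "presented_gen X R x = word_eq X R `` {[(x, True)]}"

lemma class_in_presented_group:
  "u \<in> words X \<Longrightarrow> word_eq X R `` {u} \<in> carrier (presented_group X R)"
  by (simp add: presented_group_def quotientI)

lemma presented_group_cases:
  assumes "P \<in> carrier (presented_group X R)"
  obtains u where "u \<in> words X" "P = word_eq X R `` {u}"
  using assms by (auto simp: presented_group_def elim: quotientE)

lemma presented_gen_closed [simp]:
  "x \<in> X \<Longrightarrow> presented_gen X R x \<in> carrier (presented_group X R)"
  by (simp add: presented_gen_def class_in_presented_group)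

lemma one_presented_group: "\<one>\<^bsub>presented_group X R\<^esub> = word_eq X R `` {[]}"
  by (simp add: presented_group_def)

lemma inv_presented_gen:
  assumes "x \<in> X"
  shows "inv\<^bsub>presented_group X R\<^esub> (presented_gen X R x) = word_eq X R `` {[(x, False)]}"
proof -
  interpret group "presented_group X R" by (rule group_presented_group)
  have "([(x, False)] @ [(x, True)], []) \<in> word_eq X R"
    using word_eq.cancel[of "[]" X "[]" x False R] assms by simp
  then have "word_eq X R `` {[(x, False)]} \<otimes>\<^bsub>presented_group X R\<^esub> presented_gen X R x
      = \<one>\<^bsub>presented_group X R\<^esub>"
    using assms
    by (simp add: presented_gen_def presented_group_mult one_presented_group
        equiv_class_eq[OF equiv_word_eq])
  then show ?thesis
    using assms by (intro inv_equality) (auto simp: class_in_presented_group)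
qed

text \<open>The class of a word is the value of that word at the generators, so equalities and
  generation statements about classes reduce to statements about values of words.\<close>

lemma class_eq_word_val:
  assumes "u \<in> words X"
  shows "word_eq X R `` {u} = word_val (presented_group X R) (presented_gen X R) u"
  using assms
proof (induction u)
  case Nil
  then show ?case by (simp add: one_presented_group)
next
  case (Cons a u)
  obtain x b where a: "a = (x, b)" by (cases a)
  have "word_eq X R `` {[(x, b)] @ u}
      = word_eq X R `` {[(x, b)]} \<otimes>\<^bsub>presented_group X R\<^esub> word_eq X R `` {u}"
    using Cons.prems a by (subst presented_group_mult) auto
  then show ?case using Cons a by (cases b) (auto simp: presented_gen_def inv_presented_gen[symmetric])
qed

lemma generate_presented_group:
  "generate (presented_group X R) (presented_gen X R ` X) = carrier (presented_group X R)"
proof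
  interpret group "presented_group X R" by (rule group_presented_group)
  show "generate (presented_group X R) (presented_gen X R ` X) \<subseteq> carrier (presented_group X R)"
    by (intro generate_incl) auto
  show "carrier (presented_group X R) \<subseteq> generate (presented_group X R) (presented_gen X R ` X)"
  proof
    fix P assume "P \<in> carrier (presented_group X R)"
    then obtain u where u: "u \<in> words X" "P = word_eq X R `` {u}" by (rule presented_group_cases)
    have "word_val (presented_group X R) (presented_gen X R) u
        \<in> generate (presented_group X R) (presented_gen X R ` X)"
      using u(1)
    proof (induction u)
      case (Cons a u)
      then show ?case by (cases a) (auto intro: generate.intros)
    qed (simp add: generate.one)
    with u show "P \<in> generate (presented_group X R) (presented_gen X R ` X)"
      by (simp add: class_eq_word_val)
  qed
qed

lemma presented_group_relation:
  assumes "(r, s) \<in> R" "r \<in> words X" "s \<in> words X"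
  shows "word_val (presented_group X R) (presented_gen X R) r
    = word_val (presented_group X R) (presented_gen X R) s"
proof -
  have "(r, s) \<in> word_eq X R" using word_eq.relation[of "[]" X "[]" r s R] assms by simp
  then show ?thesis
    using assms by (simp add: equiv_class_eq[OF equiv_word_eq] flip: class_eq_word_val)
qed

text \<open>Von Dyck's theorem: the value of a word does not change along the moves that generate
  \<^const>\<open>word_eq\<close>, so evaluating any representative of a class is well defined.\<close>

lemma presented_group_hom_exists:
  assumes "group H" and f: "f ` X \<subseteq> carrier H"
    and R: "\<And>r s. (r, s) \<in> R \<Longrightarrow> r \<in> words X \<Longrightarrow> s \<in> words X \<Longrightarrow> word_val H f r = word_val H f s"
  obtains h where "h \<in> hom (presented_group X R) H" "\<And>x. x \<in> X \<Longrightarrow> h (presented_gen X R x) = f x"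
proof
  interpret H: group H by fact
  define h where "h P = word_val H f (SOME u. u \<in> P)" for P
  have h: "h (word_eq X R `` {u}) = word_val H f u" if u: "u \<in> words X" for u
  proof -
    have "u \<in> word_eq X R `` {u}" using u by (simp add: word_eq.refl)
    then have "(SOME u'. u' \<in> word_eq X R `` {u}) \<in> word_eq X R `` {u}" by (rule someI)
    then show ?thesis using H.word_val_word_eq[OF f R] by (simp add: h_def)
  qed
  show "h \<in> hom (presented_group X R) H"
  proof (rule homI)
    fix P assume "P \<in> carrier (presented_group X R)"
    then obtain u where "u \<in> words X" "P = word_eq X R `` {u}" by (rule presented_group_cases)
    then show "h P \<in> carrier H" using f by (simp add: h)
  next
    fix P Q assume "P \<in> carrier (presented_group X R)" "Q \<in> carrier (presented_group X R)"
    then obtain u v where "u \<in> words X" "P = word_eq X R `` {u}" "v \<in> words X" "Q = word_eq X R `` {v}"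
      by (metis presented_group_cases)
    then show "h (P \<otimes>\<^bsub>presented_group X R\<^esub> Q) = h P \<otimes>\<^bsub>H\<^esub> h Q"
      using f by (simp add: presented_group_mult h H.word_val_append)
  qed
  show "h (presented_gen X R x) = f x" if "x \<in> X" for x
    using that f by (auto simp: presented_gen_def h)
qed


section \<open>The universal property of HNN-extensions\<close>

abbreviation hnn_base where "hnn_base A l m a \<equiv> presented_gen (hnn_gens A) (hnn_relations A l m) (Base a)"
abbreviation hnn_stable where "hnn_stable A l m \<equiv> presented_gen (hnn_gens A) (hnn_relations A l m) Stable"

locale hnn_data = A: group A for A :: "('a, 'm) monoid_scheme" and l m :: "'a \<Rightarrow> 'a" +
  assumes l_hom: "l \<in> hom A A" and m_hom: "m \<in> hom A A"
begin

abbreviation "\<GG> \<equiv> HNN A l m"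
abbreviation "\<iota> \<equiv> hnn_base A l m"
abbreviation "\<tau> \<equiv> hnn_stable A l m"

lemma l_closed [simp]: "a \<in> carrier A \<Longrightarrow> l a \<in> carrier A"
  using l_hom by (auto simp: hom_def)

lemma m_closed [simp]: "a \<in> carrier A \<Longrightarrow> m a \<in> carrier A"
  using m_hom by (auto simp: hom_def)

lemma gens [simp]: "Stable \<in> hnn_gens A" "Base a \<in> hnn_gens A \<longleftrightarrow> a \<in> carrier A"
  by (auto simp: hnn_gens_def)

sublocale G: group \<GG>
  by (simp add: HNN_def group_presented_group)

lemma base_closed [simp]: "a \<in> carrier A \<Longrightarrow> \<iota> a \<in> carrier \<GG>"
  and stable_closed [simp]: "\<tau> \<in> carrier \<GG>"
  by (simp_all add: HNN_def)

lemma base_hom: "\<iota> \<in> hom A \<GG>"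
proof (rule homI)
  fix a b assume ab: "a \<in> carrier A" "b \<in> carrier A"
  have "word_val \<GG> (presented_gen (hnn_gens A) (hnn_relations A l m)) [(Base a, True), (Base b, True)]
      = word_val \<GG> (presented_gen (hnn_gens A) (hnn_relations A l m)) [(Base (a \<otimes>\<^bsub>A\<^esub> b), True)]"
    unfolding HNN_def by (rule presented_group_relation) (use ab in \<open>auto simp: hnn_relations_def\<close>)
  then show "\<iota> (a \<otimes>\<^bsub>A\<^esub> b) = \<iota> a \<otimes>\<^bsub>\<GG>\<^esub> \<iota> b" using ab by simp
qed simp

sublocale base: group_hom A \<GG> \<iota>
  by unfold_locales (rule base_hom)

lemma stable_relation:
  assumes a: "a \<in> carrier A"
  shows "\<iota> (l a) \<otimes>\<^bsub>\<GG>\<^esub> \<tau> = \<tau> \<otimes>\<^bsub>\<GG>\<^esub> \<iota> (m a)"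
proof -
  have "word_val \<GG> (presented_gen (hnn_gens A) (hnn_relations A l m))
        [(Stable, False), (Base (l a), True), (Stable, True)]
      = word_val \<GG> (presented_gen (hnn_gens A) (hnn_relations A l m)) [(Base (m a), True)]"
    unfolding HNN_def by (rule presented_group_relation) (use a in \<open>auto simp: hnn_relations_def\<close>)
  then have "inv\<^bsub>\<GG>\<^esub> \<tau> \<otimes>\<^bsub>\<GG>\<^esub> (\<iota> (l a) \<otimes>\<^bsub>\<GG>\<^esub> \<tau>) = \<iota> (m a)"
    using a by simp
  then show ?thesis using a by (metis G.inv_solve_left G.m_closed base_closed l_closed m_closed stable_closed)
qed

lemma generate_HNN: "generate \<GG> (insert \<tau> (\<iota> ` carrier A)) = carrier \<GG>"
  using generate_presented_group[of "hnn_gens A" "hnn_relations A l m"]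
  by (simp add: HNN_def hnn_gens_def image_image)

text \<open>The conjugation relation is required in the form \<open>\<lambda>(a) t = t \<mu>(a)\<close>, which is easy to check in a
  group of permutations because it has no inverses. The lemma is applied to the integers, to get the exponent sum
  of the stable letter, and to the permutations of the normal forms.\<close>

lemma hom_exists:
  assumes "group H" "p \<in> hom A H" "s \<in> carrier H"
    and rel: "\<And>a. a \<in> carrier A \<Longrightarrow> p (l a) \<otimes>\<^bsub>H\<^esub> s = s \<otimes>\<^bsub>H\<^esub> p (m a)"
  obtains h where "h \<in> hom \<GG> H" "\<And>a. a \<in> carrier A \<Longrightarrow> h (\<iota> a) = p a" "h \<tau> = s"
proof -
  interpret H: group H by fact
  interpret p: group_hom A H p using assms by unfold_locales
  define f where "f = case_hnn_gen p s"
  have "f ` hnn_gens A \<subseteq> carrier H"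
    using assms by (auto simp: hnn_gens_def f_def)
  moreover have "word_val H f u = word_val H f v" if "(u, v) \<in> hnn_relations A l m" for u v
    using that assms by (auto simp: hnn_relations_def f_def rel simp flip: H.m_assoc H.inv_solve_left)
  ultimately obtain h where "h \<in> hom (presented_group (hnn_gens A) (hnn_relations A l m)) H"
    "\<And>x. x \<in> hnn_gens A \<Longrightarrow> h (presented_gen (hnn_gens A) (hnn_relations A l m) x) = f x"
    using presented_group_hom_exists[OF assms(1), of f "hnn_gens A" "hnn_relations A l m"] by metis
  then show thesis by (intro that[of h]) (auto simp: HNN_def f_def)
qed

end


section \<open>Folner sets\<close>

text \<open>If every ratio \<open>f (n + 1) / f n\<close> were above \<open>1 + \<delta>\<close>, then \<open>f\<close> would grow exponentially.\<close>

lemma polynomial_growth_ratio: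
  fixes f :: "nat \<Rightarrow> nat" and \<delta> :: real
  assumes le: "\<And>n. f n \<le> Suc n ^ k" and pos: "0 < f 0" and "\<delta> > 0"
  obtains n where "f (Suc n) \<le> (1 + \<delta>) * f n"
proof (rule ccontr)
  assume "\<not> thesis"
  then have step: "(1 + \<delta>) * f n < f (Suc n)" for n using that by (meson not_le)
  have exp_le: "(1 + \<delta>) ^ n \<le> f n" for n
  proof (induction n)
    case 0
    then show ?case using pos by simp
  next
    case (Suc n)
    have "(1 + \<delta>) ^ Suc n \<le> (1 + \<delta>) * f n" using mult_left_mono[OF Suc, of "1 + \<delta>"] \<open>\<delta> > 0\<close> by simp
    then show ?case using step[of n] by simp
  qed
  have "((\<lambda>n. real (Suc n) ^ k / (1 + \<delta>) ^ n) \<longlongrightarrow> 0) sequentially"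
    using \<open>\<delta> > 0\<close> by real_asymp
  then have "\<forall>\<^sub>F n in sequentially. real (Suc n) ^ k / (1 + \<delta>) ^ n < 1"
    by (rule order_tendstoD) simp
  then obtain n where "real (Suc n) ^ k / (1 + \<delta>) ^ n < 1"
    using eventually_happens by force
  then have "real (Suc n) ^ k < (1 + \<delta>) ^ n" using \<open>\<delta> > 0\<close> by (simp add: divide_less_eq)
  also have "\<dots> \<le> f n" by (rule exp_le)
  also have "\<dots> \<le> real (Suc n) ^ k" using le[of n] by (metis of_nat_le_iff of_nat_power)
  finally show False by simp
qed

text \<open>The boxes of all products \<open>\<Prod>s\<in>T. s ^ e(s)\<close> with exponents \<open>e(s) \<le> n\<close> have at most
  \<open>(n + 1) ^ |T|\<close> elements, and multiplication by an element of \<open>T\<close> maps each box into the next one.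
  So a box whose successor is not much larger is almost invariant. In a group with torsion
  different exponents may give the same product, which only makes the boxes smaller.\<close>

lemma (in comm_group) folner_set_exists:
  fixes \<delta> :: real
  assumes T: "finite T" "T \<subseteq> carrier G" and "\<delta> > 0"
  obtains B where "finite B" "B \<noteq> {}" "B \<subseteq> carrier G"
    "\<And>t. t \<in> T \<Longrightarrow> card ((\<lambda>x. t \<otimes> x) ` B - B) \<le> \<delta> * card B"
proof -
  define E where "E n = (T \<rightarrow>\<^sub>E {..n})" for n :: nat
  define box where "box e = (\<Otimes>s\<in>T. s [^] (e s))" for e :: "'a \<Rightarrow> nat"
  have E: "finite (E n)" "card (E n) = Suc n ^ card T" for n
    using T by (simp_all add: E_def finite_PiE card_PiE)
  have box_closed: "box e \<in> carrier G" for e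
    unfolding box_def using T by (intro finprod_closed) auto
  have "card (box ` E n) \<le> Suc n ^ card T" for n
    using card_image_le[OF E(1)] E(2) by metis
  moreover have "0 < card (box ` E 0)"
    using E(1)[of 0] by (simp add: card_gt_0_iff E_def PiE_eq_empty_iff)
  ultimately obtain n where n: "card (box ` E (Suc n)) \<le> (1 + \<delta>) * card (box ` E n)"
    using polynomial_growth_ratio[of "\<lambda>n. card (box ` E n)"] \<open>\<delta> > 0\<close> by metis
  have mono: "box ` E n \<subseteq> box ` E (Suc n)"
    by (intro image_mono) (auto simp: E_def PiE_iff intro: le_SucI)
  have shift: "(\<lambda>x. t \<otimes> x) ` box ` E n \<subseteq> box ` E (Suc n)" if t: "t \<in> T" for t
  proof clarsimp
    fix e assume e: "e \<in> E n"
    define e' where "e' = e(t := Suc (e t))"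
    have ins: "T = insert t (T - {t})" using t by auto
    have split: "box g = t [^] g t \<otimes> (\<Otimes>s\<in>T - {t}. s [^] g s)" for g :: "'a \<Rightarrow> nat"
      unfolding box_def using T t by (subst ins, subst finprod_insert) auto
    have eq: "(\<Otimes>s\<in>T - {t}. s [^] e' s) = (\<Otimes>s\<in>T - {t}. s [^] e s)"
      using T by (intro finprod_cong') (auto simp: e'_def)
    have "(\<Otimes>s\<in>T - {t}. s [^] e s) \<in> carrier G"
      using T by (intro finprod_closed) auto
    then have "t \<otimes> box e = box e'"
      using subsetD[OF T(2) t] unfolding split[of e] split[of e'] eq
      by (simp add: e'_def m_ac)
    moreover have "e' \<in> E (Suc n)" using e t by (auto simp: E_def e'_def PiE_iff extensional_def)
    ultimately show "t \<otimes> box e \<in> box ` E (Suc n)" by blast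
  qed
  show thesis
  proof (rule that[of "box ` E n"])
    fix t assume t: "t \<in> T"
    have "card ((\<lambda>x. t \<otimes> x) ` box ` E n - box ` E n) \<le> card (box ` E (Suc n) - box ` E n)"
      using shift[OF t] E(1) by (intro card_mono) auto
    also have "\<dots> = card (box ` E (Suc n)) - card (box ` E n)"
      using mono E(1) by (intro card_Diff_subset) auto
    finally have "real (card ((\<lambda>x. t \<otimes> x) ` box ` E n - box ` E n))
        \<le> real (card (box ` E (Suc n))) - real (card (box ` E n))"
      using card_mono[OF _ mono] E(1) by (simp add: of_nat_diff)
    then show "card ((\<lambda>x. t \<otimes> x) ` box ` E n - box ` E n) \<le> \<delta> * card (box ` E n)"
      using n by (simp add: algebra_simps)
  qed (use E(1) box_closed in \<open>auto simp: E_def PiE_eq_empty_iff\<close>)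
qed

text \<open>The test vector is the normalised indicator function of the Folner set \<open>F\<close>. Since \<open>s F\<close> and
  \<open>F\<close> have the same number of elements, the symmetric difference has twice as many elements as
  \<open>s F - F\<close>, which is the factor \<open>2\<close> under the root.\<close>

lemma (in group) kazhdan_const_le_folner:
  fixes \<delta> :: real
  assumes S: "S \<subseteq> carrier G" and F: "finite F" "F \<noteq> {}" "F \<subseteq> carrier G"
    and folner: "\<And>s. s \<in> S \<Longrightarrow> card ((\<lambda>x. s \<otimes> x) ` F - F) \<le> \<delta> * card F"
  shows "kazhdan_const G S \<le> ennreal (sqrt (2 * \<delta>))"
proof -
  define c where "c = 1 / sqrt (card F)"
  define v :: "'a \<Rightarrow> complex" where "v x = (if x \<in> F then of_real c else 0)" for x
  have card_pos: "0 < card F" using F by (simp add: card_gt_0_iff)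
  have c2: "c\<^sup>2 = 1 / card F" by (simp add: c_def power_divide)
  have norm_indicator: "(\<Sum>\<^sub>\<infinity>x\<in>carrier G. (norm (w x))\<^sup>2) = card D / card F"
    "(\<lambda>x. (norm (w x))\<^sup>2) summable_on carrier G"
    if D: "finite D" "D \<subseteq> carrier G" and w: "\<And>x. x \<in> carrier G \<Longrightarrow> norm (w x) = (if x \<in> D then c else 0)"
    for w :: "'a \<Rightarrow> complex" and D
  proof -
    have "((\<lambda>x. (norm (w x))\<^sup>2) has_sum (\<Sum>x\<in>D. (norm (w x))\<^sup>2)) D"
      using D by (intro has_sum_finite) auto
    moreover have "((\<lambda>x. (norm (w x))\<^sup>2) has_sum (\<Sum>x\<in>D. (norm (w x))\<^sup>2)) D \<longleftrightarrow>
        ((\<lambda>x. (norm (w x))\<^sup>2) has_sum (\<Sum>x\<in>D. (norm (w x))\<^sup>2)) (carrier G)"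
      using D w by (intro has_sum_cong_neutral) auto
    ultimately have "((\<lambda>x. (norm (w x))\<^sup>2) has_sum (\<Sum>x\<in>D. (norm (w x))\<^sup>2)) (carrier G)" by blast
    moreover have "(\<Sum>x\<in>D. (norm (w x))\<^sup>2) = (\<Sum>x\<in>D. 1 / card F)"
      using D w by (intro sum.cong) (auto simp: c2)
    ultimately show "(\<Sum>\<^sub>\<infinity>x\<in>carrier G. (norm (w x))\<^sup>2) = card D / card F"
      "(\<lambda>x. (norm (w x))\<^sup>2) summable_on carrier G"
      by (auto simp: infsumI has_sum_imp_summable)
  qed
  have c_pos: "c > 0" using card_pos by (simp add: c_def)
  have v: "v \<in> ell2 G" "ell2_norm G v = 1"
    using norm_indicator[of F v] F card_pos c_pos by (auto simp: v_def ell2_def ell2_norm_def)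
  have diff: "ell2_norm G (\<lambda>x. left_regular G s v x - v x) \<le> sqrt (2 * \<delta>)" if s: "s \<in> S" for s
  proof -
    have sG: "s \<in> carrier G" using s S by auto
    let ?sF = "(\<lambda>x. s \<otimes> x) ` F"
    have inj: "inj_on (\<lambda>x. s \<otimes> x) F"
      using F sG by (auto simp: inj_on_def subset_eq)
    have mem: "inv s \<otimes> x \<in> F \<longleftrightarrow> x \<in> ?sF" if "x \<in> carrier G" for x
    proof
      assume "inv s \<otimes> x \<in> F"
      moreover have "x = s \<otimes> (inv s \<otimes> x)" using that sG by (simp flip: m_assoc)
      ultimately show "x \<in> ?sF" by (metis imageI)
    next
      assume "x \<in> ?sF"
      then obtain y where y: "y \<in> F" "x = s \<otimes> y" by blast
      then have "inv s \<otimes> x = y" using F sG by (simp add: subset_eq flip: m_assoc)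
      then show "inv s \<otimes> x \<in> F" using y by simp
    qed
    have lreg: "left_regular G s v x = (if x \<in> ?sF then of_real c else 0)" if "x \<in> carrier G" for x
      using that mem[OF that] by (simp add: left_regular_def v_def)
    have "finite ((?sF - F) \<union> (F - ?sF))" "(?sF - F) \<union> (F - ?sF) \<subseteq> carrier G"
      using F sG by (auto simp: subset_eq)
    moreover have "norm (left_regular G s v x - v x) = (if x \<in> (?sF - F) \<union> (F - ?sF) then c else 0)"
      if "x \<in> carrier G" for x
      using c_pos unfolding lreg[OF that] v_def by simp
    ultimately have "ell2_norm G (\<lambda>x. left_regular G s v x - v x)
        = sqrt (card ((?sF - F) \<union> (F - ?sF)) / card F)"
      unfolding ell2_norm_def by (subst norm_indicator(1)) (assumption | rule refl | simp)+
    also have "card ((?sF - F) \<union> (F - ?sF)) = card (?sF - F) + card (F - ?sF)"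
      using F by (intro card_Un_disjoint) auto
    also have "card (F - ?sF) = card (?sF - F)"
      using F card_image[OF inj] by (intro antisym card_le_sym_Diff) auto
    also have "(card (?sF - F) + card (?sF - F)) / card F \<le> 2 * \<delta>"
      using folner[OF s] card_pos by (simp add: divide_le_eq)
    finally show ?thesis by simp
  qed
  show ?thesis
    unfolding kazhdan_const_def
  proof (rule SUP_least, clarify)
    fix \<epsilon> :: real
    assume "\<forall>v\<in>ell2 G. ell2_norm G v = 1 \<longrightarrow> (\<exists>s\<in>S. \<epsilon> \<le> ell2_norm G (\<lambda>x. left_regular G s v x - v x))"
    then obtain s where "s \<in> S" "\<epsilon> \<le> ell2_norm G (\<lambda>x. left_regular G s v x - v x)"
      using v by blast
    then show "ennreal \<epsilon> \<le> ennreal (sqrt (2 * \<delta>))" using diff by (intro ennreal_leI) force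
  qed
qed


section \<open>Weak amenability\<close>

locale commuting_hnn_data = hnn_data A l m + A: comm_group A
  for A :: "('a, 'm) monoid_scheme" and l m :: "'a \<Rightarrow> 'a" +
  assumes commute: "a \<in> carrier A \<Longrightarrow> l (m a) = m (l a)"
    and images_generate: "generate A (l ` carrier A \<union> m ` carrier A) = carrier A"
begin

lemma pow_closed [simp]:
  assumes "a \<in> carrier A"
  shows "(l ^^ n) a \<in> carrier A" "(m ^^ n) a \<in> carrier A"
  using assms by (induction n) auto

lemma l_pow_hom: "l ^^ n \<in> hom A A"
proof (induction n)
  case (Suc n)
  then show ?case using l_hom by (auto simp: hom_def)
qed (simp add: hom_def)

lemma pow_commute: "a \<in> carrier A \<Longrightarrow> m ((l ^^ n) a) = (l ^^ n) (m a)"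
  by (induction n) (auto simp flip: commute)

text \<open>The identity behind weak amenability: each of the first \<open>n\<close> powers of the stable letter can
  be moved to the left of an element of \<open>\<lambda>\<^sup>n(A)\<close>, and what remains on its right is still an
  element of \<open>A\<close>. Each move replaces one \<open>\<lambda>\<close> by one \<open>\<mu>\<close>, and commutation of the two maps keeps the
  other factors \<open>\<lambda>\<close> available for the next move.\<close>

lemma base_stable_pow:
  assumes a: "a \<in> carrier A" and "j \<le> n"
  shows "\<iota> ((l ^^ n) a) \<otimes>\<^bsub>\<GG>\<^esub> \<tau> [^]\<^bsub>\<GG>\<^esub> j = \<tau> [^]\<^bsub>\<GG>\<^esub> j \<otimes>\<^bsub>\<GG>\<^esub> \<iota> ((l ^^ (n - j)) ((m ^^ j) a))"
  using \<open>j \<le> n\<close>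
proof (induction j)
  case 0
  then show ?case using a by simp
next
  case (Suc j)
  define b where "b = (l ^^ (n - Suc j)) ((m ^^ j) a)"
  have b: "b \<in> carrier A" using a by (simp add: b_def)
  have "n - j = Suc (n - Suc j)" using Suc.prems by simp
  then have lb: "(l ^^ (n - j)) ((m ^^ j) a) = l b" by (simp add: b_def)
  have mb: "(l ^^ (n - Suc j)) ((m ^^ Suc j) a) = m b" using a by (simp add: b_def pow_commute)
  have "\<iota> ((l ^^ n) a) \<otimes>\<^bsub>\<GG>\<^esub> \<tau> [^]\<^bsub>\<GG>\<^esub> Suc j = \<tau> [^]\<^bsub>\<GG>\<^esub> j \<otimes>\<^bsub>\<GG>\<^esub> (\<iota> (l b) \<otimes>\<^bsub>\<GG>\<^esub> \<tau>)"
    using Suc a b by (simp add: lb flip: G.m_assoc)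
  also have "\<dots> = \<tau> [^]\<^bsub>\<GG>\<^esub> Suc j \<otimes>\<^bsub>\<GG>\<^esub> \<iota> (m b)"
    using b by (simp add: stable_relation G.m_assoc)
  finally show ?case by (simp only: mb)
qed

text \<open>Descent from \<open>n + 1\<close> to \<open>n\<close>: the subgroup contains \<open>\<lambda>\<^sup>n(\<lambda>(A))\<close> by assumption and
  \<open>\<lambda>\<^sup>n(\<mu>(A)) = t\<^sup>-\<^sup>1 \<lambda>\<^sup>n\<^sup>+\<^sup>1(A) t\<close> by the relations, hence \<open>\<lambda>\<^sup>n(A)\<close>, because \<open>\<lambda>(A)\<close> and \<open>\<mu>(A)\<close> together
  generate \<open>A\<close>.\<close>

lemma base_in_subgroup_if_pow:
  assumes H: "subgroup H \<GG>" and "\<tau> \<in> H"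
    and "\<And>a. a \<in> carrier A \<Longrightarrow> \<iota> ((l ^^ n) a) \<in> H"
  shows "a \<in> carrier A \<Longrightarrow> \<iota> a \<in> H"
  using assms(3)
proof (induction n arbitrary: a)
  case 0
  then show ?case by simp
next
  case (Suc n)
  interpret H: subgroup H \<GG> by fact
  interpret p: group_hom A A "l ^^ n" using l_pow_hom by unfold_locales
  \<comment> \<open>conjugation of \<open>\<lambda>\<^sup>n\<^sup>+\<^sup>1(a)\<close> by \<open>t\<close>\<close>
  have m_case: "\<iota> ((l ^^ n) (m a)) \<in> H" if a: "a \<in> carrier A" for a
  proof -
    have "\<iota> ((l ^^ Suc n) a) \<otimes>\<^bsub>\<GG>\<^esub> \<tau> = \<tau> \<otimes>\<^bsub>\<GG>\<^esub> \<iota> (m ((l ^^ n) a))"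
      using a by (simp add: stable_relation)
    then have "\<iota> (m ((l ^^ n) a)) = inv\<^bsub>\<GG>\<^esub> \<tau> \<otimes>\<^bsub>\<GG>\<^esub> (\<iota> ((l ^^ Suc n) a) \<otimes>\<^bsub>\<GG>\<^esub> \<tau>)"
      using a by (simp add: G.inv_solve_left)
    then show ?thesis using a Suc.prems(2)[OF a] \<open>\<tau> \<in> H\<close> by (simp add: pow_commute)
  qed
  have "\<iota> ((l ^^ n) a) \<in> H" if "a \<in> generate A (l ` carrier A \<union> m ` carrier A)" for a
    using that
  proof (induction rule: generate.induct)
    case (incl h)
    then show ?case using m_case Suc.prems(2) by (auto simp: funpow_swap1)
  next
    case (inv h)
    then have "h \<in> carrier A" "\<iota> ((l ^^ n) h) \<in> H"
      using m_case Suc.prems(2) by (auto simp: funpow_swap1)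
    then show ?case by simp
  next
    case (eng h1 h2)
    then have "h1 \<in> carrier A" "h2 \<in> carrier A" using images_generate by auto
    with eng show ?case by simp
  qed simp
  then show ?case using Suc.IH Suc.prems(1) images_generate by blast
qed

lemma generating_set_HNN:
  assumes "finite_generating_set A S"
  shows "finite_generating_set \<GG> (insert \<tau> (\<iota> ` (l ^^ n) ` S))" (is "finite_generating_set _ ?S")
proof -
  have S: "finite S" "S \<subseteq> carrier A" "generate A S = carrier A"
    using assms by (auto simp: finite_generating_set_def)
  have SG: "?S \<subseteq> carrier \<GG>" using S by auto
  interpret H: subgroup "generate \<GG> ?S" \<GG> by (rule G.generate_is_subgroup[OF SG])
  interpret p: group_hom A A "l ^^ n" using l_pow_hom by unfold_locales
  have "\<iota> ((l ^^ n) a) \<in> generate \<GG> ?S" if "a \<in> generate A S" for a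
    using that
  proof (induction rule: generate.induct)
    case (inv h)
    then have "h \<in> carrier A" "\<iota> ((l ^^ n) h) \<in> generate \<GG> ?S"
      using S by (auto intro: generate.incl)
    then show ?case by simp
  next
    case (eng h1 h2)
    then have "h1 \<in> carrier A" "h2 \<in> carrier A" using S by auto
    with eng show ?case by simp
  qed (auto intro: generate.incl)
  then have "\<iota> a \<in> generate \<GG> ?S" if "a \<in> carrier A" for a
    using base_in_subgroup_if_pow[OF H.subgroup_axioms, of n] that S(3)
    by (auto intro: generate.incl)
  then have "generate \<GG> (insert \<tau> (\<iota> ` carrier A)) \<subseteq> generate \<GG> ?S"
    by (intro G.generate_subgroup_incl[OF _ H.subgroup_axioms]) (auto intro: generate.incl)
  then show ?thesis
    using S SG G.generate_incl[OF SG] by (auto simp: finite_generating_set_def generate_HNN)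
qed

lemma degree_hom:
  obtains d where "d \<in> hom \<GG> integer_group" "\<And>a. a \<in> carrier A \<Longrightarrow> d (\<iota> a) = 0" "d \<tau> = 1"
proof -
  have "(\<lambda>_. 0) \<in> hom A integer_group" by (auto simp: hom_def)
  from hom_exists[OF group_integer_group this, of 1] show thesis using that by auto
qed

text \<open>The Folner set is \<open>F = {t\<^sup>j b. j < n, b \<in> B}\<close>. Multiplication by \<open>t\<close> only moves the last of the
  \<open>n\<close> layers out of \<open>F\<close>. Multiplication by \<open>\<lambda>\<^sup>n(s)\<close> maps \<open>t\<^sup>j A\<close> to itself and acts on it as
  multiplication of \<open>A\<close> by \<open>\<lambda>\<^sup>n\<^sup>-\<^sup>j(\<mu>\<^sup>j(s))\<close>. So \<open>B\<close> has to be almost invariant under finitely many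
  elements of the image of \<open>A\<close>, which is abelian. The layers are disjoint because the exponent sum of \<open>t\<close>
  distinguishes them.\<close>

lemma folner_set_HNN:
  assumes S: "finite S" "S \<subseteq> carrier A" and n: "n > 0"
  obtains F where "finite F" "F \<noteq> {}" "F \<subseteq> carrier \<GG>"
    "\<And>s. s \<in> insert \<tau> (\<iota> ` (l ^^ n) ` S) \<Longrightarrow>
       card ((\<lambda>x. s \<otimes>\<^bsub>\<GG>\<^esub> x) ` F - F) \<le> 1 / n * card F"
proof -
  \<comment> \<open>the element of \<open>A\<close> through which \<open>\<lambda>\<^sup>n(s)\<close> acts on the \<open>j\<close>-th layer\<close>
  define w where "w j s = \<iota> ((l ^^ (n - j)) ((m ^^ j) s))" for j s
  define C where "C = \<GG>\<lparr>carrier := \<iota> ` carrier A\<rparr>"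
  have "comm_group C"
    using A.hom_imp_img_comm_group[OF base_hom] by (simp add: C_def)
  then interpret C: comm_group C .
  define W where "W = (\<lambda>(j, s). w j s) ` ({..<n} \<times> S)"
  have "finite W" "W \<subseteq> carrier C" using S by (auto simp: W_def w_def C_def)
  then obtain B where B: "finite B" "B \<noteq> {}" "B \<subseteq> carrier C"
    "\<And>t. t \<in> W \<Longrightarrow> card ((\<lambda>x. t \<otimes>\<^bsub>C\<^esub> x) ` B - B) \<le> 1 / n * card B"
    using C.folner_set_exists[of W "1 / n"] n by auto
  have BG: "b \<in> carrier \<GG>" if "b \<in> B" for b using B(3) that by (auto simp: C_def)
  define F where "F = (\<lambda>(j, b). \<tau> [^]\<^bsub>\<GG>\<^esub> j \<otimes>\<^bsub>\<GG>\<^esub> b) ` ({..<n} \<times> B)"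
  have F: "finite F" "F \<noteq> {}" "F \<subseteq> carrier \<GG>"
    using B n BG by (auto simp: F_def)
  have "inj_on (\<lambda>(j, b). \<tau> [^]\<^bsub>\<GG>\<^esub> j \<otimes>\<^bsub>\<GG>\<^esub> b) ({..<n} \<times> B)"
  proof (rule inj_onI, clarify)
    fix i j :: nat and b c assume bc: "b \<in> B" "c \<in> B"
      and eq: "\<tau> [^]\<^bsub>\<GG>\<^esub> i \<otimes>\<^bsub>\<GG>\<^esub> b = \<tau> [^]\<^bsub>\<GG>\<^esub> j \<otimes>\<^bsub>\<GG>\<^esub> c"
    obtain d where d: "d \<in> hom \<GG> integer_group" "\<And>a. a \<in> carrier A \<Longrightarrow> d (\<iota> a) = 0" "d \<tau> = 1"
      using degree_hom by blast
    interpret d: group_hom \<GG> integer_group d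
      using d(1) G.group_axioms by (simp add: group_hom_def group_hom_axioms_def)
    have "d (\<tau> [^]\<^bsub>\<GG>\<^esub> i \<otimes>\<^bsub>\<GG>\<^esub> b) = i" if "b \<in> B" for i :: nat and b
    proof -
      have "d b = 0" using that B(3) d(2) by (auto simp: C_def)
      moreover have "d (\<tau> [^]\<^bsub>\<GG>\<^esub> i) = i" using d(3) by (simp add: d.hom_nat_pow)
      ultimately show ?thesis using BG[OF that] by simp
    qed
    then have "i = j" using eq bc by (metis of_nat_eq_iff)
    then show "i = j \<and> b = c" using eq bc BG by simp
  qed
  then have card_F: "card F = n * card B"
    unfolding F_def by (simp add: card_image card_cartesian_product)
  have "card ((\<lambda>x. s \<otimes>\<^bsub>\<GG>\<^esub> x) ` F - F) \<le> 1 / n * card F" if s: "s \<in> insert \<tau> (\<iota> ` (l ^^ n) ` S)" for s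
  proof -
    \<comment> \<open>one layer out of \<open>n\<close> for \<open>s = t\<close>; at most a proportion \<open>1 / n\<close> of every layer otherwise\<close>
    have "card ((\<lambda>x. s \<otimes>\<^bsub>\<GG>\<^esub> x) ` F - F) \<le> real (card B)"
    proof (cases "s = \<tau>")
      case True
      have "(\<lambda>x. \<tau> \<otimes>\<^bsub>\<GG>\<^esub> x) ` F - F \<subseteq> (\<lambda>b. \<tau> [^]\<^bsub>\<GG>\<^esub> n \<otimes>\<^bsub>\<GG>\<^esub> b) ` B"
      proof clarify
        fix x assume "x \<in> F" and notin: "\<tau> \<otimes>\<^bsub>\<GG>\<^esub> x \<notin> F"
        then obtain j b where jb: "j < n" "b \<in> B" "x = \<tau> [^]\<^bsub>\<GG>\<^esub> j \<otimes>\<^bsub>\<GG>\<^esub> b"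
          by (auto simp: F_def)
        then have shift: "\<tau> \<otimes>\<^bsub>\<GG>\<^esub> x = \<tau> [^]\<^bsub>\<GG>\<^esub> Suc j \<otimes>\<^bsub>\<GG>\<^esub> b"
          using BG by (simp only: G.nat_pow_Suc2 G.m_assoc stable_closed G.nat_pow_closed)
        have "Suc j = n"
        proof (rule ccontr)
          assume "Suc j \<noteq> n"
          then have "(Suc j, b) \<in> {..<n} \<times> B" using jb by auto
          then have "\<tau> \<otimes>\<^bsub>\<GG>\<^esub> x \<in> F" unfolding F_def shift by force
          then show False using notin by simp
        qed
        then show "\<tau> \<otimes>\<^bsub>\<GG>\<^esub> x \<in> (\<lambda>b. \<tau> [^]\<^bsub>\<GG>\<^esub> n \<otimes>\<^bsub>\<GG>\<^esub> b) ` B"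
          using shift jb by auto
      qed
      then have "card ((\<lambda>x. \<tau> \<otimes>\<^bsub>\<GG>\<^esub> x) ` F - F) \<le> card B"
        using B(1) by (meson card_image_le card_mono finite_imageI le_trans)
      then show ?thesis using True by simp
    next
      case False
      then obtain a where a: "a \<in> S" "s = \<iota> ((l ^^ n) a)" using s by auto
      define D where "D j = (\<lambda>x. w j a \<otimes>\<^bsub>\<GG>\<^esub> x) ` B - B" for j
      have "(\<lambda>x. s \<otimes>\<^bsub>\<GG>\<^esub> x) ` F - F \<subseteq> (\<Union>j<n. (\<lambda>x. \<tau> [^]\<^bsub>\<GG>\<^esub> j \<otimes>\<^bsub>\<GG>\<^esub> x) ` D j)"
      proof clarify
        fix x assume "x \<in> F" and notin: "s \<otimes>\<^bsub>\<GG>\<^esub> x \<notin> F"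
        then obtain j b where jb: "j < n" "b \<in> B" "x = \<tau> [^]\<^bsub>\<GG>\<^esub> j \<otimes>\<^bsub>\<GG>\<^esub> b"
          by (auto simp: F_def)
        have aA: "a \<in> carrier A" using a S by auto
        have "s \<otimes>\<^bsub>\<GG>\<^esub> x = (\<iota> ((l ^^ n) a) \<otimes>\<^bsub>\<GG>\<^esub> \<tau> [^]\<^bsub>\<GG>\<^esub> j) \<otimes>\<^bsub>\<GG>\<^esub> b"
          using aA jb BG a by (simp add: G.m_assoc)
        also have "\<dots> = \<tau> [^]\<^bsub>\<GG>\<^esub> j \<otimes>\<^bsub>\<GG>\<^esub> (w j a \<otimes>\<^bsub>\<GG>\<^esub> b)"
          using aA jb BG by (simp add: base_stable_pow G.m_assoc w_def)
        finally have shift: "s \<otimes>\<^bsub>\<GG>\<^esub> x = \<tau> [^]\<^bsub>\<GG>\<^esub> j \<otimes>\<^bsub>\<GG>\<^esub> (w j a \<otimes>\<^bsub>\<GG>\<^esub> b)" .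
        have "w j a \<otimes>\<^bsub>\<GG>\<^esub> b \<notin> B"
          using notin jb unfolding shift F_def by auto
        then have "w j a \<otimes>\<^bsub>\<GG>\<^esub> b \<in> D j" using jb by (auto simp: D_def)
        then show "s \<otimes>\<^bsub>\<GG>\<^esub> x \<in> (\<Union>j<n. (\<lambda>x. \<tau> [^]\<^bsub>\<GG>\<^esub> j \<otimes>\<^bsub>\<GG>\<^esub> x) ` D j)"
          using jb shift by auto
      qed
      then have "card ((\<lambda>x. s \<otimes>\<^bsub>\<GG>\<^esub> x) ` F - F) \<le> card (\<Union>j<n. (\<lambda>x. \<tau> [^]\<^bsub>\<GG>\<^esub> j \<otimes>\<^bsub>\<GG>\<^esub> x) ` D j)"
        using B(1) by (intro card_mono) (auto simp: D_def)
      also have "\<dots> \<le> (\<Sum>j<n. card ((\<lambda>x. \<tau> [^]\<^bsub>\<GG>\<^esub> j \<otimes>\<^bsub>\<GG>\<^esub> x) ` D j))"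
        by (rule card_UN_le) simp
      also have "\<dots> \<le> (\<Sum>j<n. card (D j))"
        using B(1) by (intro sum_mono card_image_le) (auto simp: D_def)
      finally have "real (card ((\<lambda>x. s \<otimes>\<^bsub>\<GG>\<^esub> x) ` F - F)) \<le> (\<Sum>j<n. real (card (D j)))"
        by (metis of_nat_le_iff of_nat_sum)
      also have "\<dots> \<le> (\<Sum>j<n. 1 / n * card B)"
      proof (rule sum_mono)
        fix j assume "j \<in> {..<n}"
        then have "w j a \<in> W" using a by (force simp: W_def)
        from B(4)[OF this] show "real (card (D j)) \<le> 1 / n * card B"
          by (simp add: D_def C_def)
      qed
      also have "\<dots> = card B" using n by simp
      finally show ?thesis .
    qed
    then show ?thesis using n by (simp add: card_F)
  qed
  with F show thesis by (rule that)
qed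

lemma weakly_amenable_HNN:
  assumes "finitely_generated A"
  shows "weakly_amenable \<GG>"
proof -
  obtain S where S: "finite_generating_set A S" using assms by (auto simp: finitely_generated_def)
  have le: "uniform_kazhdan_const \<GG> \<le> ennreal (sqrt (2 * (1 / n)))" if n: "n > 0" for n :: nat
  proof -
    define Sn where "Sn = insert \<tau> (\<iota> ` (l ^^ n) ` S)"
    have gen: "finite_generating_set \<GG> Sn" unfolding Sn_def by (rule generating_set_HNN[OF S])
    have "finite S" "S \<subseteq> carrier A" using S by (auto simp: finite_generating_set_def)
    then obtain F where "finite F" "F \<noteq> {}" "F \<subseteq> carrier \<GG>"
      "\<And>s. s \<in> Sn \<Longrightarrow> card ((\<lambda>x. s \<otimes>\<^bsub>\<GG>\<^esub> x) ` F - F) \<le> 1 / n * card F"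
      using folner_set_HNN[OF _ _ n] unfolding Sn_def by metis
    then have "kazhdan_const \<GG> Sn \<le> ennreal (sqrt (2 * (1 / n)))"
      using gen by (intro G.kazhdan_const_le_folner) (auto simp: finite_generating_set_def)
    moreover have "uniform_kazhdan_const \<GG> \<le> kazhdan_const \<GG> Sn"
      unfolding uniform_kazhdan_const_def using gen by (intro INF_lower) simp
    ultimately show ?thesis by (rule order_trans[rotated])
  qed
  have "(\<lambda>n. ennreal (sqrt (2 * (1 / real n)))) \<longlonglongrightarrow> ennreal 0"
    by (intro tendsto_ennrealI) real_asymp
  then have "uniform_kazhdan_const \<GG> \<le> ennreal 0"
    by (rule LIMSEQ_le_const) (use le in \<open>auto intro!: exI[of _ 1]\<close>)
  then show ?thesis
    using generating_set_HNN[OF S] by (auto simp: weakly_amenable_def finitely_generated_def)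
qed

end


section \<open>Actions without invariant means\<close>

text \<open>The mean on \<open>X\<close> is the push-forward of the mean on the group along an orbit map
  \<open>g \<mapsto> g x\<^sub>0\<close>.\<close>

lemma (in group) amenable_action_invariant_mean:
  fixes X :: "'x set"
  assumes "amenable G" and act: "act \<in> hom G (BijGroup X)" and "x\<^sub>0 \<in> X"
  obtains \<nu> :: "'x set \<Rightarrow> real" where
    "\<And>Y. Y \<subseteq> X \<Longrightarrow> 0 \<le> \<nu> Y" "\<nu> X = 1"
    "\<And>Y Z. Y \<subseteq> X \<Longrightarrow> Z \<subseteq> X \<Longrightarrow> Y \<inter> Z = {} \<Longrightarrow> \<nu> (Y \<union> Z) = \<nu> Y + \<nu> Z"
    "\<And>g Y. g \<in> carrier G \<Longrightarrow> Y \<subseteq> X \<Longrightarrow> \<nu> (act g ` Y) = \<nu> Y"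
proof -
  obtain \<mu> :: "'a set \<Rightarrow> real" where "(\<forall>X. X \<subseteq> carrier G \<longrightarrow> 0 \<le> \<mu> X) \<and>
     (\<forall>X Y. X \<subseteq> carrier G \<longrightarrow> Y \<subseteq> carrier G \<longrightarrow> X \<inter> Y = {} \<longrightarrow> \<mu> (X \<union> Y) = \<mu> X + \<mu> Y) \<and>
     (\<forall>g \<in> carrier G. \<forall>X. X \<subseteq> carrier G \<longrightarrow> \<mu> (g <# X) = \<mu> X) \<and> \<mu> (carrier G) = 1"
    using assms(1) unfolding amenable_def by (elim exE)
  then have \<mu>: "\<And>Y. Y \<subseteq> carrier G \<Longrightarrow> 0 \<le> \<mu> Y" "\<mu> (carrier G) = 1"
      "\<And>Y Z. Y \<subseteq> carrier G \<Longrightarrow> Z \<subseteq> carrier G \<Longrightarrow> Y \<inter> Z = {} \<Longrightarrow> \<mu> (Y \<union> Z) = \<mu> Y + \<mu> Z"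
      "\<And>g Y. g \<in> carrier G \<Longrightarrow> Y \<subseteq> carrier G \<Longrightarrow> \<mu> (g <# Y) = \<mu> Y"
    by simp_all
  have Bij: "act g \<in> Bij X" if "g \<in> carrier G" for g
    using hom_in_carrier[OF act that] by (simp add: BijGroup_def)
  have act_X: "act g x \<in> X" if "g \<in> carrier G" "x \<in> X" for g x
    using Bij_imp_funcset[OF Bij] that by auto
  have act_mult: "act (g \<otimes> h) x = act g (act h x)" if "g \<in> carrier G" "h \<in> carrier G" "x \<in> X" for g h x
    using that Bij hom_mult[OF act] by (simp add: BijGroup_def compose_def)
  have act_one: "act \<one> x = x" if "x \<in> X" for x
    using that hom_one[OF act group_axioms group_BijGroup] by (simp add: BijGroup_def)
  define orb where "orb Y = {g \<in> carrier G. act g x\<^sub>0 \<in> Y}" for Y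
  have orb_image: "orb (act g ` Y) = g <# orb Y" if g: "g \<in> carrier G" and Y: "Y \<subseteq> X" for g Y
  proof (intro Set.set_eqI iffI)
    fix h assume "h \<in> orb (act g ` Y)"
    then obtain y where h: "h \<in> carrier G" and y: "y \<in> Y" "act h x\<^sub>0 = act g y" by (auto simp: orb_def)
    have "act (inv g \<otimes> h) x\<^sub>0 = act (inv g) (act g y)" using g h \<open>x\<^sub>0 \<in> X\<close> y by (simp add: act_mult)
    also have "\<dots> = act (inv g \<otimes> g) y" by (rule act_mult[symmetric]) (use g Y y in auto)
    also have "\<dots> = y" using g Y y by (simp add: act_one subset_eq)
    finally have "inv g \<otimes> h \<in> orb Y" using g h y by (simp add: orb_def)
    moreover have "h = g \<otimes> (inv g \<otimes> h)" using g h by (simp flip: m_assoc)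
    ultimately show "h \<in> g <# orb Y" unfolding l_coset_def by blast
  next
    fix h assume "h \<in> g <# orb Y"
    then show "h \<in> orb (act g ` Y)"
      using g \<open>x\<^sub>0 \<in> X\<close> by (auto simp: l_coset_def orb_def act_mult)
  qed
  show thesis
  proof (rule that[of "\<lambda>Y. \<mu> (orb Y)"])
    show "0 \<le> \<mu> (orb Y)" for Y by (rule \<mu>(1)) (auto simp: orb_def)
    have "orb X = carrier G" using act_X \<open>x\<^sub>0 \<in> X\<close> by (auto simp: orb_def)
    then show "\<mu> (orb X) = 1" using \<mu>(2) by simp
    show "\<mu> (orb (Y \<union> Z)) = \<mu> (orb Y) + \<mu> (orb Z)" if "Y \<inter> Z = {}" for Y Z
    proof -
      have "orb (Y \<union> Z) = orb Y \<union> orb Z" by (auto simp: orb_def)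
      then show ?thesis using that by (simp, intro \<mu>(3)) (auto simp: orb_def)
    qed
    show "\<mu> (orb (act g ` Y)) = \<mu> (orb Y)" if "g \<in> carrier G" "Y \<subseteq> X" for g Y
      unfolding orb_image[OF that] by (rule \<mu>(4)[OF that(1)]) (auto simp: orb_def)
  qed
qed

text \<open>An invariant mean \<open>\<nu>\<close> would satisfy \<open>\<nu> T + \<nu> U = 1\<close>, since \<open>t\<close> maps the complement of \<open>U\<close>
  onto \<open>T\<close>. But two disjoint copies of each of \<open>T\<close> and \<open>U\<close> fit into the space, so twice this sum
  is at most \<open>1\<close>.\<close>

lemma (in group) not_amenable_if_ping_pong:
  fixes X :: "'x set"
  assumes act: "act \<in> hom G (BijGroup X)" and "X \<noteq> {}" "T \<subseteq> X" "U \<subseteq> X"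
    and t: "t \<in> carrier G" and c: "c \<in> carrier G"
    and image: "act t ` (X - U) = T"
    and disj: "T \<inter> act c ` T = {}" "U \<inter> act c ` U = {}" "(T \<union> act c ` T) \<inter> (U \<union> act c ` U) = {}"
  shows "\<not> amenable G"
proof
  assume "amenable G"
  obtain x\<^sub>0 where "x\<^sub>0 \<in> X" using \<open>X \<noteq> {}\<close> by blast
  obtain \<nu> :: "'x set \<Rightarrow> real" where
    pos: "\<And>Y. Y \<subseteq> X \<Longrightarrow> 0 \<le> \<nu> Y" and total: "\<nu> X = 1"
    and add: "\<And>Y Z. Y \<subseteq> X \<Longrightarrow> Z \<subseteq> X \<Longrightarrow> Y \<inter> Z = {} \<Longrightarrow> \<nu> (Y \<union> Z) = \<nu> Y + \<nu> Z"
    and inva: "\<And>g Y. g \<in> carrier G \<Longrightarrow> Y \<subseteq> X \<Longrightarrow> \<nu> (act g ` Y) = \<nu> Y"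
    using amenable_action_invariant_mean[OF \<open>amenable G\<close> act \<open>x\<^sub>0 \<in> X\<close>] by metis
  have "act c \<in> Bij X" using hom_in_carrier[OF act c] by (simp add: BijGroup_def)
  then have cX: "act c ` Y \<subseteq> X" if "Y \<subseteq> X" for Y
    using that Bij_imp_funcset by blast
  have compl: "\<nu> (X - Y) = 1 - \<nu> Y" if "Y \<subseteq> X" for Y
  proof -
    have "Y \<union> (X - Y) = X" using that by blast
    then show ?thesis using add[of Y "X - Y"] that total by auto
  qed
  have "\<nu> T = 1 - \<nu> U"
    using inva[OF t, of "X - U"] image compl[OF \<open>U \<subseteq> X\<close>] by simp
  moreover have "\<nu> ((T \<union> act c ` T) \<union> (U \<union> act c ` U)) = 2 * \<nu> T + 2 * \<nu> U"
    using assms(3,4) cX disj inva[OF c] by (subst add; simp add: add)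
  moreover have "\<nu> Y \<le> 1" if "Y \<subseteq> X" for Y
    using compl[OF that] pos[of "X - Y"] by auto
  then have "\<nu> ((T \<union> act c ` T) \<union> (U \<union> act c ` U)) \<le> 1"
    using assms(3,4) cX by simp
  ultimately show False by simp
qed


section \<open>The action on normal forms\<close>

locale injective_hnn_data = hnn_data +
  assumes l_inj: "inj_on l (carrier A)" and m_inj: "inj_on m (carrier A)"
begin

text \<open>The exponent \<open>1\<close> of the stable letter is encoded by \<^const>\<open>True\<close> and \<open>-1\<close> by \<^const>\<open>False\<close>. An
  element of an associated subgroup can cross the stable letter:
  \<open>t \<mu>(b) = \<lambda>(b) t\<close> and \<open>t\<^sup>-\<^sup>1 \<lambda>(b) = \<mu>(b) t\<^sup>-\<^sup>1\<close>. Both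
  equations read \<open>t\<^sup>e emb e b = emb (\<not> e) b t\<^sup>e\<close>, so that one argument serves both signs.\<close>

definition emb :: "bool \<Rightarrow> 'a \<Rightarrow> 'a" where
  "emb e = (if e then m else l)"

abbreviation emb_image :: "bool \<Rightarrow> 'a set" where
  "emb_image e \<equiv> emb e ` carrier A"

text \<open>Every base element is \<open>emb e (coset_part e a) \<cdot> coset_rep e a\<close>. The subgroup itself is
  represented by the neutral element: cancellation of \<open>t t\<^sup>-\<^sup>1\<close> is detected by this value.\<close>

definition coset_rep :: "bool \<Rightarrow> 'a \<Rightarrow> 'a" where
  "coset_rep e a = (if a \<in> emb_image e then \<one>\<^bsub>A\<^esub> else SOME x. x \<in> emb_image e #>\<^bsub>A\<^esub> a)"

definition coset_part :: "bool \<Rightarrow> 'a \<Rightarrow> 'a" where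
  "coset_part e a = inv_into (carrier A) (emb e) (a \<otimes>\<^bsub>A\<^esub> inv\<^bsub>A\<^esub> (coset_rep e a))"

lemma emb_hom: "emb e \<in> hom A A" and emb_inj: "inj_on (emb e) (carrier A)"
  using l_hom m_hom l_inj m_inj by (simp_all add: emb_def)

sublocale emb: group_hom A A "emb e" for e
  by unfold_locales (rule emb_hom)

lemma subgroup_emb_image: "subgroup (emb_image e) A"
  by (rule emb.img_is_subgroup)

lemma decompose:
  assumes a: "a \<in> carrier A"
  shows "coset_rep e a \<in> carrier A" "coset_part e a \<in> carrier A"
    "emb e (coset_part e a) \<otimes>\<^bsub>A\<^esub> coset_rep e a = a"
proof -
  interpret K: subgroup "emb_image e" A by (rule subgroup_emb_image)
  have "\<exists>k \<in> emb_image e. coset_rep e a = k \<otimes>\<^bsub>A\<^esub> a"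
  proof (cases "a \<in> emb_image e")
    case True
    then have "\<one>\<^bsub>A\<^esub> = inv\<^bsub>A\<^esub> a \<otimes>\<^bsub>A\<^esub> a" "inv\<^bsub>A\<^esub> a \<in> emb_image e" using a by auto
    then show ?thesis using True by (intro bexI[of _ "inv\<^bsub>A\<^esub> a"]) (simp_all add: coset_rep_def)
  next
    case False
    have "a \<in> emb_image e #>\<^bsub>A\<^esub> a" using a A.rcos_self subgroup_emb_image by blast
    then have "(SOME x. x \<in> emb_image e #>\<^bsub>A\<^esub> a) \<in> emb_image e #>\<^bsub>A\<^esub> a" by (rule someI)
    then show ?thesis using False by (auto simp: coset_rep_def r_coset_def)
  qed
  then obtain k where k: "k \<in> emb_image e" "coset_rep e a = k \<otimes>\<^bsub>A\<^esub> a" by blast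
  have kA: "k \<in> carrier A" using k(1) by auto
  then show rep: "coset_rep e a \<in> carrier A" using k a by simp
  have "a \<otimes>\<^bsub>A\<^esub> inv\<^bsub>A\<^esub> (coset_rep e a) = inv\<^bsub>A\<^esub> k"
    using k(2) kA a by (simp add: A.inv_mult_group flip: A.m_assoc)
  then have im: "a \<otimes>\<^bsub>A\<^esub> inv\<^bsub>A\<^esub> (coset_rep e a) \<in> emb_image e" using k(1) by simp
  show "coset_part e a \<in> carrier A" unfolding coset_part_def by (rule inv_into_into[OF im])
  have "emb e (coset_part e a) = a \<otimes>\<^bsub>A\<^esub> inv\<^bsub>A\<^esub> (coset_rep e a)"
    unfolding coset_part_def by (rule f_inv_into_f[OF im])
  then show "emb e (coset_part e a) \<otimes>\<^bsub>A\<^esub> coset_rep e a = a"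
    using a rep by (simp add: A.m_assoc)
qed

lemma coset_rep_mult:
  assumes "a \<in> carrier A" "b \<in> carrier A"
  shows "coset_rep e (emb e b \<otimes>\<^bsub>A\<^esub> a) = coset_rep e a"
proof -
  interpret K: subgroup "emb_image e" A by (rule subgroup_emb_image)
  have b: "emb e b \<in> emb_image e" using assms by simp
  have "emb_image e #>\<^bsub>A\<^esub> (emb e b \<otimes>\<^bsub>A\<^esub> a) = (emb_image e #>\<^bsub>A\<^esub> emb e b) #>\<^bsub>A\<^esub> a"
    using assms by (simp add: A.coset_mult_assoc K.subset)
  also have "emb_image e #>\<^bsub>A\<^esub> emb e b = emb_image e"
    using b by (metis A.coset_join2 K.mem_carrier subgroup_emb_image)
  finally have coset: "emb_image e #>\<^bsub>A\<^esub> (emb e b \<otimes>\<^bsub>A\<^esub> a) = emb_image e #>\<^bsub>A\<^esub> a" .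
  have "a \<in> emb_image e" if "emb e b \<otimes>\<^bsub>A\<^esub> a \<in> emb_image e"
  proof -
    have "inv\<^bsub>A\<^esub> (emb e b) \<otimes>\<^bsub>A\<^esub> (emb e b \<otimes>\<^bsub>A\<^esub> a) \<in> emb_image e"
      by (rule K.m_closed[OF K.m_inv_closed[OF b] that])
    then show ?thesis using assms by (simp flip: A.m_assoc)
  qed
  then have "emb e b \<otimes>\<^bsub>A\<^esub> a \<in> emb_image e \<longleftrightarrow> a \<in> emb_image e"
    using K.m_closed[OF b] by blast
  then show ?thesis unfolding coset_rep_def coset by simp
qed

lemma coset_part_mult:
  assumes "a \<in> carrier A" "b \<in> carrier A"
  shows "coset_part e (emb e b \<otimes>\<^bsub>A\<^esub> a) = b \<otimes>\<^bsub>A\<^esub> coset_part e a"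
proof -
  let ?r = "coset_rep e a"
  have ba: "emb e b \<otimes>\<^bsub>A\<^esub> a \<in> carrier A" using assms by simp
  have "emb e (coset_part e (emb e b \<otimes>\<^bsub>A\<^esub> a)) \<otimes>\<^bsub>A\<^esub> ?r = emb e b \<otimes>\<^bsub>A\<^esub> a"
    using decompose(3)[OF ba, of e] assms by (simp add: coset_rep_mult)
  also have "\<dots> = emb e b \<otimes>\<^bsub>A\<^esub> (emb e (coset_part e a) \<otimes>\<^bsub>A\<^esub> ?r)"
    using decompose(3) assms by simp
  also have "\<dots> = emb e (b \<otimes>\<^bsub>A\<^esub> coset_part e a) \<otimes>\<^bsub>A\<^esub> ?r"
    using decompose(1,2) assms by (simp add: A.m_assoc)
  finally have "emb e (coset_part e (emb e b \<otimes>\<^bsub>A\<^esub> a)) = emb e (b \<otimes>\<^bsub>A\<^esub> coset_part e a)"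
    using A.right_cancel[where x = ?r] decompose(1)[OF assms(1)] decompose(2)[OF assms(1)]
      decompose(2)[OF ba] assms by (metis A.m_closed emb.hom_closed)
  then show ?thesis
    using inj_onD[OF emb_inj] decompose(2)[OF ba] decompose(2)[OF assms(1)] assms(2)
    by (metis A.m_closed)
qed

lemma coset_rep_one_iff: "a \<in> carrier A \<Longrightarrow> coset_rep e a = \<one>\<^bsub>A\<^esub> \<longleftrightarrow> a \<in> emb_image e"
  using decompose(2,3)[of a e] by (metis A.r_one coset_rep_def emb.hom_closed imageI)

lemma coset_rep_idem: "a \<in> carrier A \<Longrightarrow> coset_rep e (coset_rep e a) = coset_rep e a"
  using decompose[of a e] coset_rep_mult by metis

lemma coset_part_rep:
  assumes "r \<in> carrier A" "coset_rep e r = r"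
  shows "coset_part e r = \<one>\<^bsub>A\<^esub>"
proof -
  have p: "coset_part e r \<in> carrier A" by (rule decompose(2)[OF assms(1)])
  have "emb e (coset_part e r) \<otimes>\<^bsub>A\<^esub> r = r"
    using decompose(3)[OF assms(1), of e] by (simp only: assms(2))
  then have "emb e (coset_part e r) = \<one>\<^bsub>A\<^esub>"
    by (rule A.r_cancel_one[THEN iffD1, rotated 2]) (use p assms in simp_all)
  then have "emb e (coset_part e r) = emb e \<one>\<^bsub>A\<^esub>" by simp
  from inj_onD[OF emb_inj this] p show ?thesis by simp
qed

abbreviation starts :: "bool \<Rightarrow> (bool \<times> 'a) list \<Rightarrow> bool" where
  "starts e w \<equiv> w \<noteq> [] \<and> fst (hd w) = e"

text \<open>The pair \<open>(a, [(e\<^sub>1, r\<^sub>1), \<dots>, (e\<^sub>k, r\<^sub>k)])\<close> stands for the Britton normal form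
  \<open>a t\<^sup>e\<^sup>1 r\<^sub>1 \<dots> t\<^sup>e\<^sup>k r\<^sub>k\<close>. The last clause forbids the subwords \<open>t\<^sup>e 1 t\<^sup>-\<^sup>e\<close>.\<close>

primrec reduced :: "(bool \<times> 'a) list \<Rightarrow> bool" where
  "reduced [] \<longleftrightarrow> True"
| "reduced (x # w) \<longleftrightarrow> snd x \<in> carrier A \<and> coset_rep (fst x) (snd x) = snd x \<and> reduced w \<and>
     \<not> (snd x = \<one>\<^bsub>A\<^esub> \<and> starts (\<not> fst x) w)"

definition normal_forms :: "('a \<times> (bool \<times> 'a) list) set" where
  "normal_forms = carrier A \<times> Collect reduced"

text \<open>Left multiplication of a normal form by \<open>t\<^sup>e\<close>: the part of \<open>a\<close> in the associated subgroup
  passes to the left, and then \<open>t\<^sup>e\<close> either cancels against the first stable letter or becomes the new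
  first stable letter.\<close>

definition step :: "bool \<Rightarrow> 'a \<times> (bool \<times> 'a) list \<Rightarrow> 'a \<times> (bool \<times> 'a) list" where
  "step e = (\<lambda>(a, w).
     if a \<in> emb_image e \<and> starts (\<not> e) w
     then (emb (\<not> e) (coset_part e a) \<otimes>\<^bsub>A\<^esub> snd (hd w), tl w)
     else (emb (\<not> e) (coset_part e a), (e, coset_rep e a) # w))"

text \<open>These are exactly the results of a multiplication by \<open>t\<^sup>e\<close> without cancellation.\<close>

definition starting :: "bool \<Rightarrow> ('a \<times> (bool \<times> 'a) list) set" where
  "starting e = {(a, w) \<in> normal_forms. a \<in> emb_image (\<not> e) \<and> starts e w}"

text \<open>Cancellation and insertion of a stable letter undo each other. In the case of cancellation
  the result cannot lie in \<open>starting e\<close>: the released element \<open>r\<close> would then be trivial and followed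
  by \<open>t\<^sup>e\<close>, although it was preceded by \<open>t\<^sup>-\<^sup>e\<close> in a reduced form.\<close>

lemma step_props:
  assumes x: "x \<in> normal_forms"
  shows "step e x \<in> normal_forms" "step (\<not> e) (step e x) = x"
    "step e x \<in> starting e \<longleftrightarrow> x \<notin> starting (\<not> e)"
proof -
  obtain a w where aw: "x = (a, w)" "a \<in> carrier A" "reduced w"
    using x by (auto simp: normal_forms_def)
  let ?p = "coset_part e a" and ?r = "coset_rep e a"
  note dec = decompose[OF aw(2), of e]
  have "step e x \<in> normal_forms \<and> step (\<not> e) (step e x) = x \<and>
    (step e x \<in> starting e \<longleftrightarrow> x \<notin> starting (\<not> e))"
  proof (cases "a \<in> emb_image e \<and> starts (\<not> e) w")
    case True
    then obtain r v where w: "w = (\<not> e, r) # v" by (cases w) auto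
    have r: "r \<in> carrier A" "coset_rep (\<not> e) r = r" "reduced v" "\<not> (r = \<one>\<^bsub>A\<^esub> \<and> starts e v)"
      using aw w by auto
    have sx: "step e x = (emb (\<not> e) ?p \<otimes>\<^bsub>A\<^esub> r, v)" using True w aw by (simp add: step_def)
    have rep: "coset_rep (\<not> e) (emb (\<not> e) ?p \<otimes>\<^bsub>A\<^esub> r) = r"
      "coset_part (\<not> e) (emb (\<not> e) ?p \<otimes>\<^bsub>A\<^esub> r) = ?p"
      using r dec by (simp_all add: coset_rep_mult coset_part_mult coset_part_rep)
    have closed: "emb (\<not> e) ?p \<otimes>\<^bsub>A\<^esub> r \<in> carrier A" using r dec by simp
    have notin: "\<not> (emb (\<not> e) ?p \<otimes>\<^bsub>A\<^esub> r \<in> emb_image (\<not> e) \<and> starts e v)"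
      using coset_rep_one_iff[OF closed, of "\<not> e"] rep r by auto
    have "?r = \<one>\<^bsub>A\<^esub>" using True aw coset_rep_one_iff by blast
    then have "emb e ?p = a" using dec by simp
    moreover have "step (\<not> e) (emb (\<not> e) ?p \<otimes>\<^bsub>A\<^esub> r, v) = (emb e ?p, (\<not> e, r) # v)"
      by (simp only: step_def prod.case not_not notin if_False rep)
    ultimately have "step (\<not> e) (step e x) = x" unfolding sx by (simp add: aw w)
    moreover have "step e x \<notin> starting e" using notin by (auto simp: sx starting_def)
    moreover have "x \<in> starting (\<not> e)" using True x aw by (simp add: starting_def)
    ultimately show ?thesis using closed r sx by (simp add: normal_forms_def)
  next
    case False
    then have sx: "step e x = (emb (\<not> e) ?p, (e, ?r) # w)" using aw by (auto simp: step_def)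
    have "reduced ((e, ?r) # w)"
      using False aw dec coset_rep_one_iff[OF aw(2), of e] by (auto simp: coset_rep_idem)
    then have nf: "step e x \<in> normal_forms" using sx dec by (simp add: normal_forms_def)
    have one_rep: "coset_rep (\<not> e) \<one>\<^bsub>A\<^esub> = \<one>\<^bsub>A\<^esub>"
      using coset_rep_one_iff[of "\<one>\<^bsub>A\<^esub>" "\<not> e"] emb.hom_one[of "\<not> e"] by (metis A.one_closed imageI)
    have "coset_part (\<not> e) (emb (\<not> e) ?p \<otimes>\<^bsub>A\<^esub> \<one>\<^bsub>A\<^esub>) = ?p"
      using dec one_rep by (subst coset_part_mult) (simp_all add: coset_part_rep)
    then have "coset_part (\<not> e) (emb (\<not> e) ?p) = ?p" using dec by simp
    then have "step (\<not> e) (step e x) = x"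
      using dec unfolding sx by (simp add: step_def aw)
    moreover have "step e x \<in> starting e" using nf dec by (simp add: sx starting_def)
    moreover have "x \<notin> starting (\<not> e)" using False by (auto simp: starting_def aw)
    ultimately show ?thesis using nf by simp
  qed
  then show "step e x \<in> normal_forms" "step (\<not> e) (step e x) = x"
    "step e x \<in> starting e \<longleftrightarrow> x \<notin> starting (\<not> e)" by auto
qed

lemma step_bij: "bij_betw (step e) normal_forms normal_forms"
  using step_props(1,2)[of _ e] step_props(1,2)[of _ "\<not> e"]
  by (intro bij_betw_byWitness[where f' = "step (\<not> e)"]) auto

lemma step_image: "step e ` (normal_forms - starting (\<not> e)) = starting e"
proof
  show "step e ` (normal_forms - starting (\<not> e)) \<subseteq> starting e"
    using step_props(3) by auto
  show "starting e \<subseteq> step e ` (normal_forms - starting (\<not> e))"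
  proof
    fix y assume y: "y \<in> starting e"
    then have nf: "y \<in> normal_forms" by (auto simp: starting_def)
    have "y = step e (step (\<not> e) y)" using step_props(2)[OF nf, of "\<not> e"] by simp
    moreover have "step (\<not> e) y \<in> normal_forms - starting (\<not> e)"
      using step_props(1,3)[OF nf, of "\<not> e"] y by simp
    ultimately show "y \<in> step e ` (normal_forms - starting (\<not> e))" by (rule image_eqI)
  qed
qed

definition translate :: "'a \<Rightarrow> 'a \<times> (bool \<times> 'a) list \<Rightarrow> 'a \<times> (bool \<times> 'a) list" where
  "translate b = (\<lambda>(a, w). (b \<otimes>\<^bsub>A\<^esub> a, w))"

lemma translate_closed: "b \<in> carrier A \<Longrightarrow> x \<in> normal_forms \<Longrightarrow> translate b x \<in> normal_forms"
  by (auto simp: translate_def normal_forms_def)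

lemma translate_mult:
  "b \<in> carrier A \<Longrightarrow> c \<in> carrier A \<Longrightarrow> x \<in> normal_forms \<Longrightarrow>
    translate (b \<otimes>\<^bsub>A\<^esub> c) x = translate b (translate c x)"
  by (auto simp: translate_def normal_forms_def A.m_assoc)

lemma translate_bij:
  assumes "b \<in> carrier A"
  shows "bij_betw (translate b) normal_forms normal_forms"
proof (rule bij_betw_byWitness[where f' = "translate (inv\<^bsub>A\<^esub> b)"])
  show "\<forall>x\<in>normal_forms. translate (inv\<^bsub>A\<^esub> b) (translate b x) = x"
    "\<forall>x\<in>normal_forms. translate b (translate (inv\<^bsub>A\<^esub> b) x) = x"
    using assms by (auto simp: translate_def normal_forms_def simp flip: A.m_assoc)
qed (use assms translate_closed in auto)

lemma step_translate:
  assumes b: "b \<in> carrier A" and x: "x \<in> normal_forms"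
  shows "step e (translate (emb e b) x) = translate (emb (\<not> e) b) (step e x)"
proof -
  obtain a w where aw: "x = (a, w)" "a \<in> carrier A" "reduced w"
    using x by (auto simp: normal_forms_def)
  have "emb e b \<otimes>\<^bsub>A\<^esub> a \<in> emb_image e \<longleftrightarrow> a \<in> emb_image e"
    using coset_rep_one_iff coset_rep_mult b aw by (metis A.m_closed emb.hom_closed)
  moreover have "snd (hd w) \<in> carrier A" if "w \<noteq> []"
    using aw that by (cases w) auto
  ultimately show ?thesis
    using b aw decompose(2)[OF aw(2), of e]
    by (simp add: step_def translate_def coset_rep_mult coset_part_mult A.m_assoc)
qed

text \<open>This is the permutation representation of van der Waerden's proof of the normal form theorem:
  translations and multiplication by \<open>t\<close> satisfy the defining relations by \<open>step_translate\<close>.\<close>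

lemma normal_form_action:
  obtains act where "act \<in> hom \<GG> (BijGroup normal_forms)"
    "\<And>b x. b \<in> carrier A \<Longrightarrow> x \<in> normal_forms \<Longrightarrow> act (\<iota> b) x = translate b x"
    "\<And>x. x \<in> normal_forms \<Longrightarrow> act \<tau> x = step True x"
proof -
  let ?X = normal_forms
  define p where "p b = restrict (translate b) ?X" for b
  define s where "s = restrict (step True) ?X"
  have p: "p b \<in> Bij ?X" if "b \<in> carrier A" for b
    using translate_bij[OF that] by (simp add: p_def Bij_def)
  have s: "s \<in> Bij ?X"
    using step_bij by (simp add: s_def Bij_def)
  have "p \<in> hom A (BijGroup ?X)"
  proof (rule homI)
    fix b c assume bc: "b \<in> carrier A" "c \<in> carrier A"
    have "p (b \<otimes>\<^bsub>A\<^esub> c) = compose ?X (p b) (p c)"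
      using bc translate_closed by (auto simp: p_def compose_def translate_mult)
    then show "p (b \<otimes>\<^bsub>A\<^esub> c) = p b \<otimes>\<^bsub>BijGroup ?X\<^esub> p c"
      using bc p by (simp add: BijGroup_def)
  qed (simp add: p BijGroup_def)
  moreover have "s \<in> carrier (BijGroup ?X)" using s by (simp add: BijGroup_def)
  moreover have "p (l a) \<otimes>\<^bsub>BijGroup ?X\<^esub> s = s \<otimes>\<^bsub>BijGroup ?X\<^esub> p (m a)" if a: "a \<in> carrier A" for a
  proof -
    have "translate (l a) (step True x) = step True (translate (m a) x)" if "x \<in> ?X" for x
      using step_translate[OF a that, of True] by (simp add: emb_def)
    then have "compose ?X (p (l a)) s = compose ?X s (p (m a))"
      using a step_props(1) translate_closed by (auto simp: compose_def p_def s_def)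
    then show ?thesis using a p s by (simp add: BijGroup_def)
  qed
  ultimately obtain h where "h \<in> hom \<GG> (BijGroup ?X)" "\<And>a. a \<in> carrier A \<Longrightarrow> h (\<iota> a) = p a" "h \<tau> = s"
    using hom_exists[OF group_BijGroup] by metis
  then show thesis by (intro that[of h]) (auto simp: p_def s_def)
qed

text \<open>The two ping-pong sets are the normal forms that start with \<open>t\<close> and with \<open>t\<^sup>-\<^sup>1\<close>, preceded by
  an element of the corresponding associated subgroup. An element \<open>c\<close> of \<open>A\<close> outside both subgroups
  moves each of these sets off itself and does not change the sign of the first stable letter.\<close>

lemma not_amenable_HNN:
  assumes proper: "l ` carrier A \<union> m ` carrier A \<noteq> carrier A"
  shows "\<not> amenable \<GG>"
proof -
  obtain act where act: "act \<in> hom \<GG> (BijGroup normal_forms)"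
    "\<And>b x. b \<in> carrier A \<Longrightarrow> x \<in> normal_forms \<Longrightarrow> act (\<iota> b) x = translate b x"
    "\<And>x. x \<in> normal_forms \<Longrightarrow> act \<tau> x = step True x"
    using normal_form_action by blast
  obtain c where c: "c \<in> carrier A" "\<And>e. c \<notin> emb_image e"
  proof -
    have "l ` carrier A \<union> m ` carrier A \<subseteq> carrier A" by auto
    then obtain c where "c \<in> carrier A" "c \<notin> l ` carrier A" "c \<notin> m ` carrier A"
      using proper by blast
    then show thesis by (intro that[of c]) (auto simp: emb_def)
  qed
  have nf: "starting e \<subseteq> normal_forms" for e by (auto simp: starting_def)
  have moved: "fst y \<notin> emb_image (\<not> e)" "starts e (snd y)" if y: "y \<in> act (\<iota> c) ` starting e" for e y
  proof -
    obtain a w where aw: "(a, w) \<in> starting e" "y = act (\<iota> c) (a, w)" using y by auto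
    then have "y = (c \<otimes>\<^bsub>A\<^esub> a, w)" using act(2)[OF c(1), of "(a, w)"] nf by (auto simp: translate_def)
    moreover have a: "a \<in> emb_image (\<not> e)" "starts e w" using aw by (auto simp: starting_def)
    moreover have "c \<otimes>\<^bsub>A\<^esub> a \<notin> emb_image (\<not> e)"
    proof
      interpret K: subgroup "emb_image (\<not> e)" A by (rule subgroup_emb_image)
      assume "c \<otimes>\<^bsub>A\<^esub> a \<in> emb_image (\<not> e)"
      then have "c \<otimes>\<^bsub>A\<^esub> a \<otimes>\<^bsub>A\<^esub> inv\<^bsub>A\<^esub> a \<in> emb_image (\<not> e)"
        using a by (metis K.m_closed K.m_inv_closed)
      then show False using c a(1) K.subset by (auto simp: A.m_assoc)
    qed
    ultimately show "fst y \<notin> emb_image (\<not> e)" "starts e (snd y)" by auto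
  qed
  have inv_start: "fst y \<in> emb_image (\<not> e)" "starts e (snd y)" if "y \<in> starting e" for e y
    using that by (auto simp: starting_def)
  show ?thesis
  proof (rule G.not_amenable_if_ping_pong[OF act(1)])
    have "(\<one>\<^bsub>A\<^esub>, []) \<in> normal_forms" by (simp add: normal_forms_def)
    then show "normal_forms \<noteq> {}" by blast
    show "act \<tau> ` (normal_forms - starting False) = starting True"
      using step_image[of True] act(3) by simp
    show "starting True \<inter> act (\<iota> c) ` starting True = {}"
      "starting False \<inter> act (\<iota> c) ` starting False = {}"
      using moved(1) inv_start(1) by blast+
    have start: "starts e (snd y)" if "y \<in> starting e \<union> act (\<iota> c) ` starting e" for e y
      using that moved(2) inv_start(2) by blast
    show "(starting True \<union> act (\<iota> c) ` starting True) \<inter>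
        (starting False \<union> act (\<iota> c) ` starting False) = {}"
    proof (rule equals0I)
      fix y assume "y \<in> (starting True \<union> act (\<iota> c) ` starting True) \<inter>
        (starting False \<union> act (\<iota> c) ` starting False)"
      then show False using start[of y True] start[of y False] by blast
    qed
  qed (use nf c in auto)
qed

end


section \<open>HNN-extensions along commuting monomorphisms\<close>

theorem theorem2p1:
  fixes A :: "('a, 'm) monoid_scheme" and l m :: "'a \<Rightarrow> 'a"
  assumes "comm_group A"
    and "finitely_generated A"
    and "l \<in> mon A A"
    and "m \<in> mon A A"
    and "\<forall>a \<in> carrier A. l (m a) = m (l a)"
    and "generate A (l ` carrier A \<union> m ` carrier A) = carrier A"
    and "l ` carrier A \<union> m ` carrier A \<noteq> carrier A"
  shows "group (HNN A l m) \<and> finitely_generated (HNN A l m) \<and>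
    weakly_amenable (HNN A l m) \<and> \<not> amenable (HNN A l m)"
proof -
  have mon: "l \<in> hom A A" "m \<in> hom A A" "inj_on l (carrier A)" "inj_on m (carrier A)"
    using assms(3,4) by (auto simp: mon_def)
  interpret A: comm_group A by fact
  interpret commuting_hnn_data A l m
    using mon assms(5,6) by unfold_locales auto
  interpret injective_hnn_data A l m
    using mon by unfold_locales
  show ?thesis
    using weakly_amenable_HNN[OF assms(2)] not_amenable_HNN[OF assms(7)] G.group_axioms
    by (auto simp: weakly_amenable_def)
qed

end
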